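(* The Green ring $r(D_4)$ is not finitely generated as a ring.
   Context: Let $k$ be an algebraically closed field with $\mathrm{char}(k)\neq 2$. All modules are finite-dimensional left modules; $\otimes=\otimes_k$. $D_4$ is the $k$-algebra generated by $a,b,c,d$ subject to $ba=-ab$, $db=-bd$, $ca=-ac$, $dc=-cd$, $bc=cb$, $a^2=0$, $b^2=1$, $c^2=1$, $d^2=0$, $da+ad=1-bc$. It is a $16$-dimensional Hopf algebra (isomorphic to the Drinfeld double of Sweedler's 4-dimensional Hopf algebra) with comultiplication $\Delta(a)=a\otimes b+1\otimes a$, $\Delta(b)=b\otimes b$, $\Delta(c)=c\otimes c$, $\Delta(d)=d\otimes c+1\otimes d$, counit $\varepsilon(a)=\varepsilon(d)=0$, $\varepsilon(b)=\varepsilon(c)=1$, antipode $S(a)=-ab$, $S(b)=b$, $S(c)=c$, $S(d)=-dc$. Tensor products of $D_4$-modules are $D_4$-modules via $\Delta$. The Green ring $r(D_4)$ is the abelian group generated by isomorphism classes $[M]$ of finite-dimensional $D_4$-modules modulo the relations $[M\oplus N]=[M]+[N]$, with multiplication $[M][N]=[M\otimes N]$ and identity $[k]$, $k$ the trivial module given by $\varepsilon$. It is commutative since $D_4$ is quasitriangular. *)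

theory Defs
  imports
    "Jordan_Normal_Form.Matrix"
    "Jordan_Normal_Form.Determinant"
    "HOL-Library.Poly_Mapping"
    "HOL-Algebra.Generated_Rings"
    "HOL-Algebra.Algebraic_Closure_Type"
begin

section \<open>The Hopf algebra \<open>D\<^sub>4\<close>\<close>

subsection \<open>The algebra\<close>

datatype 'k d4_term =
    TA | TB | TC | TD
  | TScal 'k
  | TAdd "'k d4_term" "'k d4_term"
  | TMul "'k d4_term" "'k d4_term"

text \<open>
  The least congruence on terms that contains the axioms of a unital associative \<open>k\<close>-algebra (with
  \<open>TScal c\<close> read as \<open>c \<cdot> 1\<close>) and the defining relations of \<open>D\<^sub>4\<close>.
\<close>
inductive d4_eq :: "'k::field d4_term \<Rightarrow> 'k d4_term \<Rightarrow> bool" where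
  refl: "d4_eq x x"
| sym: "d4_eq x y \<Longrightarrow> d4_eq y x"
| trans: "d4_eq x y \<Longrightarrow> d4_eq y z \<Longrightarrow> d4_eq x z"
| add_cong: "d4_eq x x' \<Longrightarrow> d4_eq y y' \<Longrightarrow> d4_eq (TAdd x y) (TAdd x' y')"
| mul_cong: "d4_eq x x' \<Longrightarrow> d4_eq y y' \<Longrightarrow> d4_eq (TMul x y) (TMul x' y')"
| add_assoc: "d4_eq (TAdd (TAdd x y) z) (TAdd x (TAdd y z))"
| add_comm: "d4_eq (TAdd x y) (TAdd y x)"
| add_zero: "d4_eq (TAdd (TScal 0) x) x"
| add_neg: "d4_eq (TAdd (TMul (TScal (-1)) x) x) (TScal 0)"
| mul_assoc: "d4_eq (TMul (TMul x y) z) (TMul x (TMul y z))"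
| mul_one: "d4_eq (TMul (TScal 1) x) x"
| distrib_left: "d4_eq (TMul x (TAdd y z)) (TAdd (TMul x y) (TMul x z))"
| distrib_right: "d4_eq (TMul (TAdd x y) z) (TAdd (TMul x z) (TMul y z))"
| scal_add: "d4_eq (TScal (r + s)) (TAdd (TScal r) (TScal s))"
| scal_mul: "d4_eq (TScal (r * s)) (TMul (TScal r) (TScal s))"
| scal_central: "d4_eq (TMul (TScal r) x) (TMul x (TScal r))"
| rel_ba: "d4_eq (TMul TB TA) (TMul (TScal (-1)) (TMul TA TB))"
| rel_db: "d4_eq (TMul TD TB) (TMul (TScal (-1)) (TMul TB TD))"
| rel_ca: "d4_eq (TMul TC TA) (TMul (TScal (-1)) (TMul TA TC))"
| rel_dc: "d4_eq (TMul TD TC) (TMul (TScal (-1)) (TMul TC TD))"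
| rel_bc: "d4_eq (TMul TB TC) (TMul TC TB)"
| rel_aa: "d4_eq (TMul TA TA) (TScal 0)"
| rel_bb: "d4_eq (TMul TB TB) (TScal 1)"
| rel_cc: "d4_eq (TMul TC TC) (TScal 1)"
| rel_dd: "d4_eq (TMul TD TD) (TScal 0)"
| rel_da: "d4_eq (TAdd (TMul TD TA) (TMul TA TD))
                (TAdd (TScal 1) (TMul (TScal (-1)) (TMul TB TC)))"

quotient_type (overloaded) 'k d4 = "'k::field d4_term" / d4_eq
  by (intro equivpI reflpI sympI transpI) (auto intro: d4_eq.refl d4_eq.sym d4_eq.trans)

lift_definition d4_a :: "'k::field d4" is TA .
lift_definition d4_b :: "'k::field d4" is TB .
lift_definition d4_c :: "'k::field d4" is TC .
lift_definition d4_d :: "'k::field d4" is TD .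
lift_definition d4_scal :: "'k::field \<Rightarrow> 'k d4" is TScal .

primrec counit_term :: "'k::field d4_term \<Rightarrow> 'k" where
  "counit_term TA = 0"
| "counit_term TB = 1"
| "counit_term TC = 1"
| "counit_term TD = 0"
| "counit_term (TScal r) = r"
| "counit_term (TAdd x y) = counit_term x + counit_term y"
| "counit_term (TMul x y) = counit_term x * counit_term y"

lift_definition d4_counit :: "'k::field d4 \<Rightarrow> 'k" is counit_term
  subgoal for x y by (induction rule: d4_eq.induct) (auto simp: algebra_simps)
  done

instantiation d4 :: (field) ring_1
begin

lift_definition zero_d4 :: "'a d4" is "TScal 0" .
lift_definition one_d4 :: "'a d4" is "TScal 1" .
lift_definition plus_d4 :: "'a d4 \<Rightarrow> 'a d4 \<Rightarrow> 'a d4" is TAdd by (rule d4_eq.add_cong)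
lift_definition times_d4 :: "'a d4 \<Rightarrow> 'a d4 \<Rightarrow> 'a d4" is TMul by (rule d4_eq.mul_cong)
lift_definition uminus_d4 :: "'a d4 \<Rightarrow> 'a d4" is "TMul (TScal (-1))"
  by (rule d4_eq.mul_cong[OF d4_eq.refl])
definition minus_d4 :: "'a d4 \<Rightarrow> 'a d4 \<Rightarrow> 'a d4" where "minus_d4 x y = x + - y"

instance
proof
  fix x y z :: "'a d4"
  show "x + y + z = x + (y + z)" by transfer (rule d4_eq.add_assoc)
  show "x + y = y + x" by transfer (rule d4_eq.add_comm)
  show "0 + x = x" by transfer (rule d4_eq.add_zero)
  show "- x + x = 0" by transfer (rule d4_eq.add_neg)
  show "x - y = x + - y" by (rule minus_d4_def)
  show "x * y * z = x * (y * z)" by transfer (rule d4_eq.mul_assoc)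
  show "1 * x = x" by transfer (rule d4_eq.mul_one)
  show "x * 1 = x" by transfer (metis d4_eq.mul_one d4_eq.scal_central d4_eq.sym d4_eq.trans)
  show "(x + y) * z = x * z + y * z" by transfer (rule d4_eq.distrib_right)
  show "x * (y + z) = x * y + x * z" by transfer (rule d4_eq.distrib_left)
  have "d4_counit (0 :: 'a d4) = 0" "d4_counit (1 :: 'a d4) = 1" by (transfer, simp)+
  then show "(0 :: 'a d4) \<noteq> 1" by auto
qed

end

lemma d4_scal_0: "d4_scal 0 = 0" and d4_scal_1: "d4_scal 1 = 1"
  by (transfer, rule d4_eq.refl)+

lemma d4_scal_minus_one: "d4_scal (-1) * x = - x"
  by transfer (rule d4_eq.refl)

lemma d4_scal_add: "d4_scal (r + s) = d4_scal r + d4_scal s"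
  by transfer (rule d4_eq.scal_add)

lemma d4_scal_mult: "d4_scal (r * s) = d4_scal r * d4_scal s"
  by transfer (rule d4_eq.scal_mul)

lemma d4_scal_central: "d4_scal r * x = x * d4_scal r"
  by transfer (rule d4_eq.scal_central)

lemma d4_relations:
  "d4_b * d4_a = - (d4_a * d4_b)"
  "d4_d * d4_b = - (d4_b * d4_d)"
  "d4_c * d4_a = - (d4_a * d4_c)"
  "d4_d * d4_c = - (d4_c * d4_d)"
  "d4_b * d4_c = d4_c * d4_b"
  "d4_a * d4_a = 0"
  "d4_b * d4_b = 1"
  "d4_c * d4_c = 1"
  "d4_d * d4_d = 0"
  "d4_d * d4_a + d4_a * d4_d = 1 - d4_b * (d4_c :: 'k::field d4)"
  unfolding minus_d4_def
  by (transfer, rule d4_eq.rel_ba d4_eq.rel_db d4_eq.rel_ca d4_eq.rel_dc d4_eq.rel_bc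
      d4_eq.rel_aa d4_eq.rel_bb d4_eq.rel_cc d4_eq.rel_dd d4_eq.rel_da)+

lemma d4_induct [case_names a b c d scal add mult]:
  fixes x :: "'k::field d4"
  assumes "P d4_a" "P d4_b" "P d4_c" "P d4_d" "\<And>r. P (d4_scal r)"
    and "\<And>x y. P x \<Longrightarrow> P y \<Longrightarrow> P (x + y)"
    and "\<And>x y. P x \<Longrightarrow> P y \<Longrightarrow> P (x * y)"
  shows "P x"
proof -
  have "P (abs_d4 t)" for t
  proof (induction t)
    case (TAdd t1 t2)
    then show ?case using assms(6) by (simp add: plus_d4.abs_eq[symmetric])
  next
    case (TMul t1 t2)
    then show ?case using assms(7) by (simp add: times_d4.abs_eq[symmetric])
  qed (use assms in \<open>simp_all add: d4_a_def d4_b_def d4_c_def d4_d_def d4_scal.abs_eq[symmetric]\<close>)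
  then show ?thesis by (metis Quotient_abs_rep Quotient_d4)
qed

lemma d4_counit_simps [simp]:
  "d4_counit d4_a = 0" "d4_counit d4_b = 1" "d4_counit d4_c = 1" "d4_counit d4_d = 0"
  "d4_counit (d4_scal r) = r"
  "d4_counit (x + y) = d4_counit x + d4_counit y"
  "d4_counit (x * y) = d4_counit x * d4_counit y"
  by (transfer, simp)+

subsection \<open>The comultiplication\<close>

text \<open>
  A list \<open>[(u\<^sub>1, v\<^sub>1), \<dots>, (u\<^sub>r, v\<^sub>r)]\<close> stands for the element \<open>u\<^sub>1 \<otimes> v\<^sub>1 + \<dots> + u\<^sub>r \<otimes> v\<^sub>r\<close> of
  \<open>D\<^sub>4 \<otimes> D\<^sub>4\<close>. Equal elements of \<open>D\<^sub>4\<close> get lists that act equally on every tensor product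
  (\<open>tensor_term_respects\<close> below), which is all that tensor products of modules need of \<open>\<Delta>\<close>.
\<close>
primrec comult_term :: "'k::field d4_term \<Rightarrow> ('k d4 \<times> 'k d4) list" where
  "comult_term TA = [(d4_a, d4_b), (1, d4_a)]"
| "comult_term TB = [(d4_b, d4_b)]"
| "comult_term TC = [(d4_c, d4_c)]"
| "comult_term TD = [(d4_d, d4_c), (1, d4_d)]"
| "comult_term (TScal r) = [(d4_scal r, 1)]"
| "comult_term (TAdd x y) = comult_term x @ comult_term y"
| "comult_term (TMul x y) =
     [(u * u', v * v'). (u, v) \<leftarrow> comult_term x, (u', v') \<leftarrow> comult_term y]"

section \<open>Kronecker products and block sums of matrices\<close>

definition kron :: "'k::semiring_0 mat \<Rightarrow> 'k mat \<Rightarrow> 'k mat" where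
  "kron A B = mat (dim_row A * dim_row B) (dim_col A * dim_col B)
     (\<lambda>(i, j). A $$ (i div dim_row B, j div dim_col B) * B $$ (i mod dim_row B, j mod dim_col B))"

definition block_sum :: "'k::zero mat \<Rightarrow> 'k mat \<Rightarrow> 'k mat" where
  "block_sum A B =
     four_block_mat A (0\<^sub>m (dim_row A) (dim_col B)) (0\<^sub>m (dim_row B) (dim_col A)) B"

lemma dim_kron [simp]:
  "dim_row (kron A B) = dim_row A * dim_row B" "dim_col (kron A B) = dim_col A * dim_col B"
  by (simp_all add: kron_def)

lemma kron_carrier [simp]:
  "A \<in> carrier_mat m n \<Longrightarrow> B \<in> carrier_mat p q \<Longrightarrow> kron A B \<in> carrier_mat (m * p) (n * q)"
  by (intro carrier_matI) auto

lemma div_less_of_less_mult: "i < m * p \<Longrightarrow> i div p < (m::nat)"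
  by (simp add: less_mult_imp_div_less)

lemma mod_less_of_less_mult: "i < m * p \<Longrightarrow> i mod p < (p::nat)"
  by (metis gr_zeroI less_nat_zero_code mod_less_divisor mult_0_right)

lemma index_kron:
  assumes "A \<in> carrier_mat m n" "B \<in> carrier_mat p q" "i < m * p" "j < n * q"
  shows "kron A B $$ (i, j) = A $$ (i div p, j div q) * B $$ (i mod p, j mod q)"
  using assms by (auto simp: kron_def)

lemma sum_div_mod:
  fixes f :: "nat \<Rightarrow> nat \<Rightarrow> 'a::comm_monoid_add"
  shows "(\<Sum>k\<in>{0..<n * q}. f (k div q) (k mod q)) = (\<Sum>i\<in>{0..<n}. \<Sum>j\<in>{0..<q}. f i j)"
proof -
  have "(\<Sum>k<n * q. f (k div q) (k mod q)) =
        (\<Sum>m<n. \<Sum>k = m * q..<m * q + q. f (k div q) (k mod q))"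
    by (rule sum.nat_group[symmetric])
  also have "\<dots> = (\<Sum>m<n. \<Sum>j\<in>{0..<q}. f m j)"
  proof (rule sum.cong[OF HOL.refl])
    fix m
    have "(\<Sum>k = m * q..<m * q + q. f (k div q) (k mod q)) =
          (\<Sum>k = 0 + m * q..<q + m * q. f (k div q) (k mod q))"
      by (simp add: add.commute)
    also have "\<dots> = (\<Sum>k = 0..<q. f ((k + m * q) div q) ((k + m * q) mod q))"
      by (rule sum.shift_bounds_nat_ivl)
    also have "\<dots> = (\<Sum>j\<in>{0..<q}. f m j)"
      by (intro sum.cong) auto
    finally show "(\<Sum>k = m * q..<m * q + q. f (k div q) (k mod q)) = (\<Sum>j\<in>{0..<q}. f m j)" .
  qed
  finally show ?thesis by (simp add: lessThan_atLeast0)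
qed

lemma kron_mult:
  fixes A :: "'k::comm_semiring_1 mat"
  assumes A: "A \<in> carrier_mat m n" and B: "B \<in> carrier_mat p q"
    and C: "C \<in> carrier_mat n r" and D: "D \<in> carrier_mat q s"
  shows "kron A B * kron C D = kron (A * C) (B * D)"
proof (rule eq_matI)
  fix i j
  assume "i < dim_row (kron (A * C) (B * D))" "j < dim_col (kron (A * C) (B * D))"
  with A B C D have i: "i < m * p" and j: "j < r * s" by auto
  note ij = div_less_of_less_mult[OF i] mod_less_of_less_mult[OF i]
    div_less_of_less_mult[OF j] mod_less_of_less_mult[OF j]
  have "(kron A B * kron C D) $$ (i, j) =
        (\<Sum>k\<in>{0..<n * q}. kron A B $$ (i, k) * kron C D $$ (k, j))"
    using A B C D i j by (simp add: scalar_prod_def)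
  also have "\<dots> = (\<Sum>k\<in>{0..<n * q}. (A $$ (i div p, k div q) * B $$ (i mod p, k mod q)) *
                       (C $$ (k div q, j div s) * D $$ (k mod q, j mod s)))"
    by (intro sum.cong) (use i j in \<open>simp_all add: index_kron[OF A B] index_kron[OF C D]\<close>)
  also have "\<dots> = (\<Sum>k\<in>{0..<n}. \<Sum>l\<in>{0..<q}. (A $$ (i div p, k) * B $$ (i mod p, l)) *
                       (C $$ (k, j div s) * D $$ (l, j mod s)))"
    by (rule sum_div_mod)
  also have "\<dots> = (\<Sum>k\<in>{0..<n}. A $$ (i div p, k) * C $$ (k, j div s)) *
                  (\<Sum>l\<in>{0..<q}. B $$ (i mod p, l) * D $$ (l, j mod s))"
    by (simp add: sum_product mult_ac)
  also have "\<dots> = (A * C) $$ (i div p, j div s) * (B * D) $$ (i mod p, j mod s)"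
    using A B C D ij by (simp add: scalar_prod_def)
  also have "\<dots> = kron (A * C) (B * D) $$ (i, j)"
    by (rule index_kron[symmetric, OF mult_carrier_mat[OF A C] mult_carrier_mat[OF B D] i j])
  finally show "(kron A B * kron C D) $$ (i, j) = kron (A * C) (B * D) $$ (i, j)" .
qed (use A B C D in auto)

lemma kron_add_left:
  assumes "A \<in> carrier_mat m n" "A' \<in> carrier_mat m n" "B \<in> carrier_mat p q"
  shows "kron (A + A') B = kron A B + kron A' B"
  using assms
  by (intro eq_matI)
     (auto simp: index_kron[of _ m n _ p q] div_less_of_less_mult semiring_class.distrib_right)

lemma kron_add_right:
  assumes "A \<in> carrier_mat m n" "B \<in> carrier_mat p q" "B' \<in> carrier_mat p q"
  shows "kron A (B + B') = kron A B + kron A B'"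
  using assms
  by (intro eq_matI)
     (auto simp: index_kron[of _ m n _ p q] mod_less_of_less_mult semiring_class.distrib_left)

lemma kron_zero_left [simp]: "kron (0\<^sub>m m n) B = 0\<^sub>m (m * dim_row B) (n * dim_col B)"
  by (intro eq_matI) (auto simp: kron_def div_less_of_less_mult)

lemma kron_zero_right [simp]: "kron A (0\<^sub>m p q) = 0\<^sub>m (dim_row A * p) (dim_col A * q)"
  by (intro eq_matI) (auto simp: kron_def mod_less_of_less_mult)

lemma kron_smult_left: "kron (r \<cdot>\<^sub>m A) B = r \<cdot>\<^sub>m kron A (B :: 'k::comm_semiring_1 mat)"
  by (intro eq_matI) (auto simp: kron_def div_less_of_less_mult mult_ac)

lemma kron_smult_right: "kron A (r \<cdot>\<^sub>m B) = r \<cdot>\<^sub>m kron A (B :: 'k::comm_semiring_1 mat)"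
  by (intro eq_matI) (auto simp: kron_def mod_less_of_less_mult mult_ac)

lemma kron_one [simp]: "kron (1\<^sub>m m) (1\<^sub>m n) = (1\<^sub>m (m * n) :: 'k::comm_semiring_1 mat)"
proof (rule eq_matI)
  fix i j assume "i < dim_row (1\<^sub>m (m * n) :: 'k mat)" "j < dim_col (1\<^sub>m (m * n) :: 'k mat)"
  then have i: "i < m * n" and j: "j < m * n" by auto
  have "i = j \<longleftrightarrow> i div n = j div n \<and> i mod n = j mod n"
    by (metis div_mult_mod_eq)
  then show "kron (1\<^sub>m m) (1\<^sub>m n) $$ (i, j) = (1\<^sub>m (m * n) :: 'k mat) $$ (i, j)"
    using i j div_less_of_less_mult[OF i] div_less_of_less_mult[OF j]
      mod_less_of_less_mult[OF i] mod_less_of_less_mult[OF j]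
    by (simp add: index_kron[of _ m m _ n n])
qed auto

lemma kron_one_left [simp]: "kron (1\<^sub>m 1) A = (A :: 'k::comm_semiring_1 mat)"
  by (intro eq_matI) (auto simp: kron_def)

lemma kron_one_right [simp]: "kron A (1\<^sub>m 1) = (A :: 'k::comm_semiring_1 mat)"
  by (intro eq_matI) (auto simp: kron_def)

lemma kron_assoc: "kron (kron A B) C = kron A (kron B (C :: 'k::comm_semiring_1 mat))"
proof (rule eq_matI)
  fix i j
  assume "i < dim_row (kron A (kron B C))" "j < dim_col (kron A (kron B C))"
  then have i: "i < dim_row A * (dim_row B * dim_row C)" and j: "j < dim_col A * (dim_col B * dim_col C)"
    by auto
  then have i': "i < (dim_row A * dim_row B) * dim_row C" and j': "j < (dim_col A * dim_col B) * dim_col C"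
    by (simp_all add: mult.assoc)
  have aux1: "k mod (b * c) div c = k div c mod b" for k b c :: nat
    by (cases "c = 0") (simp_all add: mult.commute[of b] mod_mult2_eq)
  have aux2: "k mod (b * c) mod c = k mod c" for k b c :: nat
    by (simp add: mod_mod_cancel)
  have aux3: "k div (b * c) = k div c div b" for k b c :: nat
    by (simp add: div_mult2_eq mult.commute[of b])
  show "kron (kron A B) C $$ (i, j) = kron A (kron B C) $$ (i, j)"
    using i j i' j' div_less_of_less_mult[OF i'] div_less_of_less_mult[OF j']
      mod_less_of_less_mult[OF i] mod_less_of_less_mult[OF j]
    by (simp add: kron_def aux1 aux2 aux3 mult.assoc)
qed (auto simp: mult.assoc)

lemma block_sum_carrier [simp]:
  "A \<in> carrier_mat m n \<Longrightarrow> B \<in> carrier_mat p q \<Longrightarrow> block_sum A B \<in> carrier_mat (m + p) (n + q)"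
  by (intro carrier_matI) (auto simp: block_sum_def)

lemma block_sum_mult:
  fixes A :: "'k::semiring_1 mat"
  assumes "A \<in> carrier_mat m n" "B \<in> carrier_mat p q" "C \<in> carrier_mat n r" "D \<in> carrier_mat q s"
  shows "block_sum A B * block_sum C D = block_sum (A * C) (B * D)"
  using assms unfolding block_sum_def
  by (subst mult_four_block_mat[of _ m n _ q _ p _ _ r _ s]) (auto intro!: cong_four_block_mat)

lemma block_sum_add:
  fixes A :: "'k::semiring_1 mat"
  assumes "A \<in> carrier_mat m n" "A' \<in> carrier_mat m n" "B \<in> carrier_mat p q" "B' \<in> carrier_mat p q"
  shows "block_sum (A + A') (B + B') = block_sum A B + block_sum A' B'"
  using assms unfolding block_sum_def
  by (subst add_four_block_mat[of _ m n _ q _ p]) (auto intro!: cong_four_block_mat)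

lemma block_sum_smult_one:
  "block_sum (r \<cdot>\<^sub>m 1\<^sub>m m) (r \<cdot>\<^sub>m 1\<^sub>m n) = (r \<cdot>\<^sub>m 1\<^sub>m (m + n) :: 'k::comm_semiring_1 mat)"
  unfolding block_sum_def by (intro eq_matI) auto

section \<open>Finite-dimensional modules\<close>

text \<open>
  A left \<open>D\<^sub>4\<close>-module structure on \<open>k\<^sup>n\<close> is a homomorphism of \<open>k\<close>-algebras from \<open>D\<^sub>4\<close> to the
  \<open>n \<times> n\<close> matrices; every finite-dimensional module is isomorphic to one of these.
\<close>
definition d4_rep :: "nat \<Rightarrow> ('k::field d4 \<Rightarrow> 'k mat) \<Rightarrow> bool" where
  "d4_rep n \<rho> \<longleftrightarrow>
     (\<forall>x. \<rho> x \<in> carrier_mat n n) \<and>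
     (\<forall>x y. \<rho> (x + y) = \<rho> x + \<rho> y) \<and>
     (\<forall>x y. \<rho> (x * y) = \<rho> x * \<rho> y) \<and>
     (\<forall>r. \<rho> (d4_scal r) = r \<cdot>\<^sub>m 1\<^sub>m n)"

lemma d4_rep_counit: "d4_rep 1 (\<lambda>x. d4_counit x \<cdot>\<^sub>m 1\<^sub>m 1)"
  unfolding d4_rep_def by (auto intro!: eq_matI simp: semiring_class.distrib_right)

typedef (overloaded) 'k d4_module = "{(n, \<rho> :: 'k::field d4 \<Rightarrow> 'k mat). d4_rep n \<rho>}"
  using d4_rep_counit by blast

definition mdim :: "'k::field d4_module \<Rightarrow> nat" where
  "mdim M = fst (Rep_d4_module M)"

definition act :: "'k::field d4_module \<Rightarrow> 'k d4 \<Rightarrow> 'k mat" where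
  "act M = snd (Rep_d4_module M)"

lemma d4_rep_act: "d4_rep (mdim M) (act M)"
  using Rep_d4_module[of M] by (auto simp: mdim_def act_def)

lemma act_carrier [simp]: "act M x \<in> carrier_mat (mdim M) (mdim M)"
  and act_add: "act M (x + y) = act M x + act M y"
  and act_mult: "act M (x * y) = act M x * act M y"
  and act_scal: "act M (d4_scal r) = r \<cdot>\<^sub>m 1\<^sub>m (mdim M)"
  using d4_rep_act[of M] by (auto simp: d4_rep_def)

lemma dim_act [simp]: "dim_row (act M x) = mdim M" "dim_col (act M x) = mdim M"
  using carrier_matD[OF act_carrier[of M x]] by auto

lemma act_0: "act M 0 = 0\<^sub>m (mdim M) (mdim M)"
  using act_scal[of M 0] by (auto intro!: eq_matI simp: d4_scal_0)

lemma act_1: "act M 1 = 1\<^sub>m (mdim M)"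
  using act_scal[of M 1] by (auto intro!: eq_matI simp: d4_scal_1)

lemma act_uminus: "act M (- x) = (-1) \<cdot>\<^sub>m act M x"
proof -
  have "act M (- x) = ((-1) \<cdot>\<^sub>m 1\<^sub>m (mdim M)) * act M x"
    by (simp flip: d4_scal_minus_one add: act_mult act_scal)
  then show ?thesis by (simp add: mult_smult_assoc_mat[of _ "mdim M" "mdim M" _ "mdim M"])
qed

lemma mdim_Abs: "d4_rep n \<rho> \<Longrightarrow> mdim (Abs_d4_module (n, \<rho>)) = n"
  and act_Abs: "d4_rep n \<rho> \<Longrightarrow> act (Abs_d4_module (n, \<rho>)) = \<rho>"
  by (simp_all add: mdim_def act_def Abs_d4_module_inverse)

lemma d4_module_eqI:
  fixes M N :: "'k::field d4_module"
  assumes "mdim M = mdim N"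
    and "act M d4_a = act N d4_a" "act M d4_b = act N d4_b"
    and "act M d4_c = act N d4_c" "act M d4_d = act N d4_d"
  shows "M = N"
proof -
  have "act M x = act N x" for x
    by (induction x rule: d4_induct) (use assms in \<open>simp_all add: act_add act_mult act_scal\<close>)
  then have "act M = act N" by auto
  with assms(1) show ?thesis
    by (metis Rep_d4_module_inject act_def mdim_def prod.expand)
qed

subsection \<open>Homomorphisms\<close>

definition d4_hom :: "'k::field d4_module \<Rightarrow> 'k d4_module \<Rightarrow> 'k mat \<Rightarrow> bool" where
  "d4_hom M N P \<longleftrightarrow>
     P \<in> carrier_mat (mdim N) (mdim M) \<and> (\<forall>x. P * act M x = act N x * P)"

definition d4_iso :: "'k::field d4_module \<Rightarrow> 'k d4_module \<Rightarrow> bool" where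
  "d4_iso M N \<longleftrightarrow>
     (\<exists>P Q. d4_hom M N P \<and> d4_hom N M Q \<and> P * Q = 1\<^sub>m (mdim N) \<and> Q * P = 1\<^sub>m (mdim M))"

lemma d4_hom_carrier: "d4_hom M N P \<Longrightarrow> P \<in> carrier_mat (mdim N) (mdim M)"
  by (simp add: d4_hom_def)

lemma d4_homI:
  fixes M N :: "'k::field d4_module"
  assumes P: "P \<in> carrier_mat (mdim N) (mdim M)"
    and gen: "P * act M d4_a = act N d4_a * P" "P * act M d4_b = act N d4_b * P"
      "P * act M d4_c = act N d4_c * P" "P * act M d4_d = act N d4_d * P"
  shows "d4_hom M N P"
proof -
  have "P * act M x = act N x * P" for x
  proof (induction x rule: d4_induct)
    case (scal r)
    have "P * (r \<cdot>\<^sub>m 1\<^sub>m (mdim M)) = r \<cdot>\<^sub>m (P * 1\<^sub>m (mdim M))"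
      by (rule mult_smult_distrib[OF P one_carrier_mat])
    moreover have "(r \<cdot>\<^sub>m 1\<^sub>m (mdim N)) * P = r \<cdot>\<^sub>m (1\<^sub>m (mdim N) * P)"
      by (rule mult_smult_assoc_mat[OF one_carrier_mat P])
    ultimately show ?case using P by (simp add: act_scal)
  next
    case (add x y)
    have "P * (act M x + act M y) = P * act M x + P * act M y"
      by (rule mult_add_distrib_mat[OF P act_carrier act_carrier])
    moreover have "(act N x + act N y) * P = act N x * P + act N y * P"
      by (rule add_mult_distrib_mat[OF act_carrier act_carrier P])
    ultimately show ?case by (simp add: act_add add)
  next
    case (mult x y)
    have "P * (act M x * act M y) = (P * act M x) * act M y"
      by (rule assoc_mult_mat[symmetric, OF P act_carrier act_carrier])
    also have "\<dots> = act N x * (P * act M y)"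
      unfolding mult(1) by (rule assoc_mult_mat[OF act_carrier P act_carrier])
    also have "\<dots> = (act N x * act N y) * P"
      unfolding mult(2) by (rule assoc_mult_mat[symmetric, OF act_carrier act_carrier P])
    finally show ?case by (simp add: act_mult)
  qed (use gen in auto)
  with P show ?thesis by (simp add: d4_hom_def)
qed

lemma d4_hom_id: "d4_hom M M (1\<^sub>m (mdim M))"
  by (simp add: d4_hom_def)

lemma d4_hom_comp:
  assumes P: "d4_hom L M P" and Q: "d4_hom M N Q"
  shows "d4_hom L N (Q * P)"
proof -
  note c = d4_hom_carrier[OF P] d4_hom_carrier[OF Q]
  have "Q * P * act L x = act N x * (Q * P)" for x
  proof -
    have "Q * P * act L x = Q * (P * act L x)" by (rule assoc_mult_mat[OF c(2,1) act_carrier])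
    also have "\<dots> = Q * (act M x * P)" using P by (simp add: d4_hom_def)
    also have "\<dots> = (Q * act M x) * P" by (rule assoc_mult_mat[symmetric, OF c(2) act_carrier c(1)])
    also have "\<dots> = (act N x * Q) * P" using Q by (simp add: d4_hom_def)
    also have "\<dots> = act N x * (Q * P)" by (rule assoc_mult_mat[OF act_carrier c(2,1)])
    finally show ?thesis .
  qed
  then show ?thesis using c by (simp add: d4_hom_def)
qed

lemma d4_hom_add:
  assumes P: "d4_hom M N P" and Q: "d4_hom M N Q"
  shows "d4_hom M N (P + Q)"
proof -
  note c = d4_hom_carrier[OF P] d4_hom_carrier[OF Q]
  have "(P + Q) * act M x = act N x * (P + Q)" for x
    using P Q add_mult_distrib_mat[OF c act_carrier] mult_add_distrib_mat[OF act_carrier c]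
    by (simp add: d4_hom_def)
  then show ?thesis using c by (simp add: d4_hom_def)
qed

lemma d4_iso_refl: "d4_iso M M"
  unfolding d4_iso_def by (intro exI[of _ "1\<^sub>m (mdim M)"]) (simp add: d4_hom_id)

lemma d4_iso_sym: "d4_iso M N \<Longrightarrow> d4_iso N M"
  unfolding d4_iso_def by blast

lemma mat_cancel_middle:
  fixes A :: "'k::semiring_1 mat"
  assumes "A \<in> carrier_mat l m" "B \<in> carrier_mat m n" "C \<in> carrier_mat n m" "D \<in> carrier_mat m p"
    and "B * C = 1\<^sub>m m"
  shows "(A * B) * (C * D) = A * D"
proof -
  have "(A * B) * (C * D) = A * (B * (C * D))"
    by (rule assoc_mult_mat[OF assms(1,2) mult_carrier_mat[OF assms(3,4)]])
  also have "B * (C * D) = (B * C) * D"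
    by (rule assoc_mult_mat[symmetric, OF assms(2-4)])
  finally show ?thesis using assms by simp
qed

lemma d4_iso_trans:
  assumes "d4_iso L M" "d4_iso M N"
  shows "d4_iso L N"
proof -
  from assms(1) obtain P Q where P: "d4_hom L M P" and Q: "d4_hom M L Q"
    and PQ: "P * Q = 1\<^sub>m (mdim M)" "Q * P = 1\<^sub>m (mdim L)" by (auto simp: d4_iso_def)
  from assms(2) obtain R S where R: "d4_hom M N R" and S: "d4_hom N M S"
    and RS: "R * S = 1\<^sub>m (mdim N)" "S * R = 1\<^sub>m (mdim M)" by (auto simp: d4_iso_def)
  note c = P[THEN d4_hom_carrier] Q[THEN d4_hom_carrier] R[THEN d4_hom_carrier] S[THEN d4_hom_carrier]
  have "(R * P) * (Q * S) = R * S" by (rule mat_cancel_middle[OF c(3,1,2,4) PQ(1)])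
  moreover have "(Q * S) * (R * P) = Q * P" by (rule mat_cancel_middle[OF c(2,4,3,1) RS(2)])
  ultimately show ?thesis
    unfolding d4_iso_def using d4_hom_comp[OF P R] d4_hom_comp[OF S Q] PQ RS by auto
qed

subsection \<open>Direct sums\<close>

definition module_sum :: "'k::field d4_module \<Rightarrow> 'k d4_module \<Rightarrow> 'k d4_module" where
  "module_sum M N = Abs_d4_module (mdim M + mdim N, \<lambda>x. block_sum (act M x) (act N x))"

lemma d4_rep_sum: "d4_rep (mdim M + mdim N) (\<lambda>x. block_sum (act M x) (act N x))"
  unfolding d4_rep_def
  using block_sum_add[of "act M x" "mdim M" "mdim M" "act M y" "act N x" "mdim N" "mdim N" "act N y" for x y]
    block_sum_mult[of "act M x" "mdim M" "mdim M" "act N x" "mdim N" "mdim N" "act M y" "mdim M" "act N y" "mdim N" for x y]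
  by (auto simp: act_add act_mult act_scal block_sum_smult_one)

lemma mdim_sum [simp]: "mdim (module_sum M N) = mdim M + mdim N"
  by (simp add: module_sum_def mdim_Abs[OF d4_rep_sum])

lemma act_sum: "act (module_sum M N) x = block_sum (act M x) (act N x)"
  by (simp add: module_sum_def act_Abs[OF d4_rep_sum])

text \<open>Biproduct data, used to compare \<open>\<otimes>\<close> with direct sums up to isomorphism.\<close>
definition biproduct ::
  "'k::field d4_module \<Rightarrow> 'k d4_module \<Rightarrow> 'k d4_module \<Rightarrow> 'k mat \<Rightarrow> 'k mat \<Rightarrow> 'k mat \<Rightarrow> 'k mat \<Rightarrow> bool"
where
  "biproduct E M N i j p q \<longleftrightarrow>
     d4_hom M E i \<and> d4_hom N E j \<and> d4_hom E M p \<and> d4_hom E N q \<and>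
     p * i = 1\<^sub>m (mdim M) \<and> q * j = 1\<^sub>m (mdim N) \<and>
     p * j = 0\<^sub>m (mdim M) (mdim N) \<and> q * i = 0\<^sub>m (mdim N) (mdim M) \<and>
     i * p + j * q = 1\<^sub>m (mdim E)"

lemma biproduct_compose:
  assumes E: "biproduct E M N i j p q" and Y: "biproduct Y M N i' j' p' q'"
  shows "(i' * p + j' * q) * (i * p' + j * q') = 1\<^sub>m (mdim Y)"
proof -
  let ?m = "mdim M" and ?n = "mdim N" and ?x = "mdim E" and ?y = "mdim Y"
  have c: "i \<in> carrier_mat ?x ?m" "j \<in> carrier_mat ?x ?n" "p \<in> carrier_mat ?m ?x" "q \<in> carrier_mat ?n ?x"
    "i' \<in> carrier_mat ?y ?m" "j' \<in> carrier_mat ?y ?n" "p' \<in> carrier_mat ?m ?y" "q' \<in> carrier_mat ?n ?y"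
    using E Y by (auto simp: biproduct_def d4_hom_def)
  have rel: "p * i = 1\<^sub>m ?m" "q * j = 1\<^sub>m ?n" "p * j = 0\<^sub>m ?m ?n" "q * i = 0\<^sub>m ?n ?m"
    and rel': "i' * p' + j' * q' = 1\<^sub>m ?y"
    using E Y by (auto simp: biproduct_def)
  have p: "p * (i * p' + j * q') = p'"
  proof -
    have "p * (i * p' + j * q') = p * (i * p') + p * (j * q')"
      by (rule mult_add_distrib_mat[of _ ?m ?x _ ?y]) (use c in simp_all)
    also have "p * (i * p') = (p * i) * p'"
      by (rule assoc_mult_mat[symmetric, of _ ?m ?x _ ?m _ ?y]) (use c in simp_all)
    also have "p * (j * q') = (p * j) * q'"
      by (rule assoc_mult_mat[symmetric, of _ ?m ?x _ ?n _ ?y]) (use c in simp_all)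
    finally show ?thesis using c by (simp add: rel)
  qed
  have q: "q * (i * p' + j * q') = q'"
  proof -
    have "q * (i * p' + j * q') = q * (i * p') + q * (j * q')"
      by (rule mult_add_distrib_mat[of _ ?n ?x _ ?y]) (use c in simp_all)
    also have "q * (i * p') = (q * i) * p'"
      by (rule assoc_mult_mat[symmetric, of _ ?n ?x _ ?m _ ?y]) (use c in simp_all)
    also have "q * (j * q') = (q * j) * q'"
      by (rule assoc_mult_mat[symmetric, of _ ?n ?x _ ?n _ ?y]) (use c in simp_all)
    finally show ?thesis using c by (simp add: rel)
  qed
  have "(i' * p + j' * q) * (i * p' + j * q') = i' * p * (i * p' + j * q') + j' * q * (i * p' + j * q')"
    by (rule add_mult_distrib_mat[of _ ?y ?x _ _ ?y]) (use c in simp_all)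
  also have "i' * p * (i * p' + j * q') = i' * (p * (i * p' + j * q'))"
    by (rule assoc_mult_mat[of _ ?y ?m _ ?x _ ?y]) (use c in simp_all)
  also have "j' * q * (i * p' + j * q') = j' * (q * (i * p' + j * q'))"
    by (rule assoc_mult_mat[of _ ?y ?n _ ?x _ ?y]) (use c in simp_all)
  finally show ?thesis by (simp add: p q rel')
qed

lemma biproduct_unique:
  assumes E: "biproduct E M N i j p q" and Y: "biproduct Y M N i' j' p' q'"
  shows "d4_iso E Y"
proof -
  have "d4_hom E Y (i' * p + j' * q)" "d4_hom Y E (i * p' + j * q')"
    using E Y by (auto simp: biproduct_def intro!: d4_hom_add intro: d4_hom_comp)
  then show ?thesis
    unfolding d4_iso_def using biproduct_compose[OF E Y] biproduct_compose[OF Y E] by blast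
qed

lemma biproduct_sum: "\<exists>i j p q. biproduct (module_sum M N) M N i j p q"
proof -
  let ?m = "mdim M" and ?n = "mdim N"
  define i where "i = mat (?m + ?n) ?m (\<lambda>(k, l). if k = l then 1 else (0::'a))"
  define j where "j = mat (?m + ?n) ?n (\<lambda>(k, l). if k = ?m + l then 1 else (0::'a))"
  define p where "p = mat ?m (?m + ?n) (\<lambda>(k, l). if l = k then 1 else (0::'a))"
  define q where "q = mat ?n (?m + ?n) (\<lambda>(k, l). if l = ?m + k then 1 else (0::'a))"
  have shift: "(\<Sum>k = 0..<?n. if l = ?m + k then f k else (0::'a)) =
      (if ?m \<le> l \<and> l < ?m + ?n then f (l - ?m) else 0)" for l and f :: "nat \<Rightarrow> 'a"
  proof (cases "?m \<le> l")
    case True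
    then have "l = ?m + k \<longleftrightarrow> k = l - ?m" for k by auto
    with True show ?thesis by auto
  qed auto
  have shift': "(\<Sum>k = 0..<?n. if ?m + k = l then f k else (0::'a)) =
      (if ?m \<le> l \<and> l < ?m + ?n then f (l - ?m) else 0)" for l and f :: "nat \<Rightarrow> 'a"
    unfolding shift[of l f, symmetric] by (intro sum.cong) auto
  have split: "(\<Sum>k = 0..<?m + ?n. f k) = (\<Sum>k = 0..<?m. f k) + (\<Sum>k = 0..<?n. f (?m + k))"
    for f :: "nat \<Rightarrow> 'a"
  proof -
    have "(\<Sum>k = 0..<?m + ?n. f k) = (\<Sum>k = 0..<?m. f k) + (\<Sum>k = ?m..<?m + ?n. f k)"
      by (rule sum.atLeastLessThan_concat[symmetric]) auto
    also have "(\<Sum>k = ?m..<?m + ?n. f k) = (\<Sum>k = 0..<?n. f (?m + k))"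
      using sum.shift_bounds_nat_ivl[of f 0 ?m ?n] by (simp add: add.commute)
    finally show ?thesis .
  qed
  note s = scalar_prod_def act_sum block_sum_def split shift shift'
    if_distrib[of "\<lambda>x. x * _"] if_distrib[of "\<lambda>x. _ * x"]
  have "d4_hom M (module_sum M N) i"
    unfolding d4_hom_def i_def by (auto intro!: eq_matI simp: s cong: if_cong sum.cong_simp)
  moreover have "d4_hom N (module_sum M N) j"
    unfolding d4_hom_def j_def by (auto intro!: eq_matI simp: s cong: if_cong sum.cong_simp)
  moreover have "d4_hom (module_sum M N) M p"
    unfolding d4_hom_def p_def by (auto intro!: eq_matI simp: s cong: if_cong sum.cong_simp)
  moreover have "d4_hom (module_sum M N) N q"
    unfolding d4_hom_def q_def by (auto intro!: eq_matI simp: s cong: if_cong sum.cong_simp)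
  moreover have "p * i = 1\<^sub>m ?m" "q * j = 1\<^sub>m ?n" "p * j = 0\<^sub>m ?m ?n" "q * i = 0\<^sub>m ?n ?m"
    "i * p + j * q = 1\<^sub>m (?m + ?n)"
    unfolding i_def j_def p_def q_def by (auto intro!: eq_matI simp: s cong: if_cong sum.cong_simp)
  ultimately show ?thesis unfolding biproduct_def mdim_sum by blast
qed

lemma biproduct_iso:
  assumes E: "biproduct E M N i j p q" and "d4_iso M M'" "d4_iso N N'"
  shows "\<exists>i j p q. biproduct E M' N' i j p q"
proof -
  from assms(2) obtain P P' where P: "d4_hom M M' P" "d4_hom M' M P'"
    and PP: "P * P' = 1\<^sub>m (mdim M')" "P' * P = 1\<^sub>m (mdim M)" by (auto simp: d4_iso_def)
  from assms(3) obtain Q Q' where Q: "d4_hom N N' Q" "d4_hom N' N Q'"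
    and QQ: "Q * Q' = 1\<^sub>m (mdim N')" "Q' * Q = 1\<^sub>m (mdim N)" by (auto simp: d4_iso_def)
  let ?m = "mdim M" and ?n = "mdim N" and ?x = "mdim E" and ?m' = "mdim M'" and ?n' = "mdim N'"
  have h: "d4_hom M E i" "d4_hom N E j" "d4_hom E M p" "d4_hom E N q"
    and rel: "p * i = 1\<^sub>m ?m" "q * j = 1\<^sub>m ?n" "p * j = 0\<^sub>m ?m ?n" "q * i = 0\<^sub>m ?n ?m"
      "i * p + j * q = 1\<^sub>m ?x"
    using E by (auto simp: biproduct_def)
  note c = h[THEN d4_hom_carrier] P[THEN d4_hom_carrier] Q[THEN d4_hom_carrier]
  have mid: "(A * B) * (C * D) = A * ((B * C) * D)"
    if "A \<in> carrier_mat s t" "B \<in> carrier_mat t u" "C \<in> carrier_mat u v" "D \<in> carrier_mat v w"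
    for A B C D :: "'a mat" and s t u v w
  proof -
    have "(A * B) * (C * D) = A * (B * (C * D))"
      by (rule assoc_mult_mat[OF that(1,2) mult_carrier_mat[OF that(3,4)]])
    also have "B * (C * D) = (B * C) * D"
      by (rule assoc_mult_mat[symmetric, OF that(2-4)])
    finally show ?thesis .
  qed
  have "(P * p) * (i * P') = 1\<^sub>m ?m'"
    using mid[OF c(5,3,1,6)] c PP by (simp add: rel)
  moreover have "(Q * q) * (j * Q') = 1\<^sub>m ?n'"
    using mid[OF c(7,4,2,8)] c QQ by (simp add: rel)
  moreover have "(P * p) * (j * Q') = 0\<^sub>m ?m' ?n'"
    using mid[OF c(5,3,2,8)] c by (simp add: rel)
  moreover have "(Q * q) * (i * P') = 0\<^sub>m ?n' ?m'"
    using mid[OF c(7,4,1,6)] c by (simp add: rel)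
  moreover have "(i * P') * (P * p) + (j * Q') * (Q * q) = 1\<^sub>m ?x"
    using mat_cancel_middle[OF c(1,6,5,3) PP(2)] mat_cancel_middle[OF c(2,8,7,4) QQ(2)]
    by (simp add: rel)
  moreover note d4_hom_comp[OF P(2) h(1)] d4_hom_comp[OF Q(2) h(2)]
    d4_hom_comp[OF h(3) P(1)] d4_hom_comp[OF h(4) Q(1)]
  ultimately show ?thesis unfolding biproduct_def by blast
qed

lemma d4_iso_sum:
  assumes "d4_iso M M'" "d4_iso N N'"
  shows "d4_iso (module_sum M N) (module_sum M' N')"
  using biproduct_sum[of M N] biproduct_sum[of M' N'] biproduct_iso[OF _ assms] biproduct_unique
  by metis

subsection \<open>Tensor products\<close>

lemma d4_cb: "d4_c * d4_b = d4_b * d4_c"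
  by (simp add: d4_relations(5))

lemma d4_da: "d4_d * d4_a = 1 + (- (d4_b * d4_c) + - (d4_a * d4_d))"
proof -
  have "d4_d * d4_a = (d4_d * d4_a + d4_a * d4_d) + - (d4_a * d4_d)" by simp
  then show ?thesis unfolding d4_relations(10) by (simp add: algebra_simps)
qed

lemma act_kron_mult:
  "kron (act M u) (act N v) * kron (act M u') (act N v') =
   kron (act M (u * u')) (act N (v * v'))"
  by (simp add: act_mult
      kron_mult[of _ "mdim M" "mdim M" _ "mdim N" "mdim N" _ "mdim M" _ "mdim N"])

text \<open>
  \<open>x\<close> acts on \<open>M \<otimes> N\<close> as \<open>\<Sum> u \<otimes> v\<close>, where \<open>\<Delta>(x) = \<Sum> u \<otimes> v\<close>.
\<close>
definition tensor_term :: "'k::field d4_module \<Rightarrow> 'k d4_module \<Rightarrow> 'k d4_term \<Rightarrow> 'k mat" where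
  "tensor_term M N t =
     foldr (\<lambda>(u, v) A. kron (act M u) (act N v) + A) (comult_term t)
       (0\<^sub>m (mdim M * mdim N) (mdim M * mdim N))"

context
  fixes M N :: "'k::field d4_module"
begin

private abbreviation (input) "dd \<equiv> mdim M * mdim N"

private definition fs :: "('k d4 \<times> 'k d4) list \<Rightarrow> 'k mat" where
  "fs us = foldr (\<lambda>(u, v) A. kron (act M u) (act N v) + A) us (0\<^sub>m dd dd)"

private lemma fs_Nil: "fs [] = 0\<^sub>m dd dd"
  by (simp add: fs_def)

private lemma fs_Cons: "fs ((u, v) # us) = kron (act M u) (act N v) + fs us"
  by (simp add: fs_def)

private lemma fs_carrier: "fs us \<in> carrier_mat dd dd"
  by (induction us) (auto simp: fs_Nil fs_Cons)

private lemma K_carrier: "kron (act M u) (act N v) \<in> carrier_mat dd dd"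
  by simp

private lemma fs_append: "fs (us @ vs) = fs us + fs vs"
proof (induction us)
  case Nil
  then show ?case using fs_carrier[of vs] by (simp add: fs_Nil)
next
  case (Cons p us)
  obtain u v where "p = (u, v)" by force
  with Cons show ?case
    using assoc_add_mat[OF K_carrier fs_carrier fs_carrier] by (simp add: fs_Cons)
qed

private lemma fs_single_mult:
  "fs (map (\<lambda>(u', v'). (u * u', v * v')) vs) = kron (act M u) (act N v) * fs vs"
proof (induction vs)
  case Nil
  then show ?case using K_carrier[of u v] by (simp add: fs_Nil)
next
  case (Cons p vs)
  obtain u' v' where p: "p = (u', v')" by force
  show ?case
    unfolding p using Cons mult_add_distrib_mat[OF K_carrier K_carrier fs_carrier]
    by (simp add: fs_Cons act_kron_mult)
qed

private lemma fs_mult: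
  "fs (concat (map (\<lambda>(u, v). map (\<lambda>(u', v'). (u * u', v * v')) vs) us)) = fs us * fs vs"
proof (induction us)
  case Nil
  then show ?case using fs_carrier[of vs] by (simp add: fs_Nil)
next
  case (Cons p us)
  obtain u v where p: "p = (u, v)" by force
  show ?case
    unfolding p using Cons add_mult_distrib_mat[OF K_carrier fs_carrier fs_carrier]
    by (simp add: fs_Cons fs_append fs_single_mult)
qed

lemma tensor_term_carrier [simp]: "tensor_term M N t \<in> carrier_mat dd dd"
  using fs_carrier by (simp add: tensor_term_def fs_def)

lemma tensor_term_simps:
  "tensor_term M N TA = kron (act M d4_a) (act N d4_b) + kron (act M 1) (act N d4_a)"
  "tensor_term M N TB = kron (act M d4_b) (act N d4_b)"
  "tensor_term M N TC = kron (act M d4_c) (act N d4_c)"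
  "tensor_term M N TD = kron (act M d4_d) (act N d4_c) + kron (act M 1) (act N d4_d)"
  "tensor_term M N (TScal r) = r \<cdot>\<^sub>m 1\<^sub>m dd"
  "tensor_term M N (TAdd x y) = tensor_term M N x + tensor_term M N y"
  "tensor_term M N (TMul x y) = tensor_term M N x * tensor_term M N y"
proof -
  have fs: "tensor_term M N t = fs (comult_term t)" for t
    by (simp add: tensor_term_def fs_def)
  have r: "A + 0\<^sub>m dd dd = A" if "A \<in> carrier_mat dd dd" for A :: "'k mat"
    using that by simp
  note s = fs fs_Nil fs_Cons r[OF K_carrier]
  show "tensor_term M N TA = kron (act M d4_a) (act N d4_b) + kron (act M 1) (act N d4_a)"
    "tensor_term M N TB = kron (act M d4_b) (act N d4_b)"
    "tensor_term M N TC = kron (act M d4_c) (act N d4_c)"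
    "tensor_term M N TD = kron (act M d4_d) (act N d4_c) + kron (act M 1) (act N d4_d)"
    by (simp_all add: s)
  show "tensor_term M N (TScal r) = r \<cdot>\<^sub>m 1\<^sub>m dd"
    by (simp add: s) (simp add: act_scal act_1 kron_smult_left)
  show "tensor_term M N (TAdd x y) = tensor_term M N x + tensor_term M N y"
    by (simp add: fs fs_append)
  show "tensor_term M N (TMul x y) = tensor_term M N x * tensor_term M N y"
    using fs_mult[of "comult_term y" "comult_term x"]
    by (simp add: fs case_prod_unfold)
qed

private lemma sum4_mult:
  assumes "A \<in> carrier_mat n n" "B \<in> carrier_mat n n" "C \<in> carrier_mat n n" "D \<in> carrier_mat n n"
  shows "(A + B) * (C + D) = (A * C + A * D) + (B * C + B * (D :: 'k mat))"
  unfolding add_mult_distrib_mat[OF assms(1,2) add_carrier_mat[OF assms(4)]]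
    mult_add_distrib_mat[OF assms(1,3,4)] mult_add_distrib_mat[OF assms(2,3,4)] ..

private lemma K_rules:
  "kron (act M (u + u')) (act N v) = kron (act M u) (act N v) + kron (act M u') (act N v)"
  "kron (act M u) (act N (v + v')) = kron (act M u) (act N v) + kron (act M u) (act N v')"
  "kron (act M (- u)) (act N v) = (-1) \<cdot>\<^sub>m kron (act M u) (act N v)"
  "kron (act M u) (act N (- v)) = (-1) \<cdot>\<^sub>m kron (act M u) (act N v)"
  "kron (act M 0) (act N v) = 0\<^sub>m dd dd"
  "kron (act M u) (act N 0) = 0\<^sub>m dd dd"
  "kron (act M 1) (act N 1) = 1\<^sub>m dd"
  by (simp_all add: act_add act_uminus act_0 act_1 kron_smult_left kron_smult_right
      kron_add_left[of _ "mdim M" "mdim M" _ _ "mdim N" "mdim N"]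
      kron_add_right[of _ "mdim M" "mdim M" _ "mdim N" "mdim N"])

private lemma scal_mult_mat:
  "A \<in> carrier_mat dd dd \<Longrightarrow> (r \<cdot>\<^sub>m 1\<^sub>m dd) * A = r \<cdot>\<^sub>m (A :: 'k mat)"
  "A \<in> carrier_mat dd dd \<Longrightarrow> A * (r \<cdot>\<^sub>m 1\<^sub>m dd) = r \<cdot>\<^sub>m (A :: 'k mat)"
  by (simp_all add: mult_smult_assoc_mat[of _ dd dd _ dd] mult_smult_distrib[of _ dd dd _ dd])

lemma tensor_term_respects: "d4_eq x y \<Longrightarrow> tensor_term M N x = tensor_term M N y"
proof (induction rule: d4_eq.induct)
  case (add_assoc x y z)
  show ?case by (simp add: tensor_term_simps assoc_add_mat[of _ dd dd])
next
  case (add_comm x y)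
  show ?case by (simp add: tensor_term_simps comm_add_mat[of _ dd dd])
next
  case (add_zero x)
  show ?case by (intro eq_matI)
      (use carrier_matD[OF tensor_term_carrier] in \<open>auto simp: tensor_term_simps\<close>)
next
  case (add_neg x)
  show ?case by (intro eq_matI)
      (use carrier_matD[OF tensor_term_carrier] in \<open>auto simp: tensor_term_simps scal_mult_mat\<close>)
next
  case (mul_assoc x y z)
  show ?case by (simp add: tensor_term_simps assoc_mult_mat[of _ dd dd _ dd _ dd])
next
  case (mul_one x)
  show ?case by (intro eq_matI)
      (use carrier_matD[OF tensor_term_carrier] in \<open>auto simp: tensor_term_simps scal_mult_mat\<close>)
next
  case (distrib_left x y z)
  show ?case by (simp add: tensor_term_simps mult_add_distrib_mat[of _ dd dd _ dd])
next
  case (distrib_right x y z)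
  show ?case by (simp add: tensor_term_simps add_mult_distrib_mat[of _ dd dd _ _ dd])
next
  case (scal_add r s)
  show ?case by (intro eq_matI) (auto simp: tensor_term_simps)
next
  case (scal_mul r s)
  show ?case by (intro eq_matI) (auto simp: tensor_term_simps scal_mult_mat)
next
  case (scal_central r x)
  show ?case by (simp add: tensor_term_simps scal_mult_mat)
qed (simp_all (no_asm_simp) only: tensor_term_simps sum4_mult[OF K_carrier K_carrier K_carrier K_carrier]
      add_mult_distrib_mat[OF K_carrier K_carrier K_carrier]
      mult_add_distrib_mat[OF K_carrier K_carrier K_carrier] act_kron_mult
      d4_relations(1-4,6-9) d4_cb d4_da mult_1_left mult_1_right K_rules,
    (intro eq_matI; simp add: scal_mult_mat algebra_simps)+)

end

lift_definition tensor_act :: "'k::field d4_module \<Rightarrow> 'k d4_module \<Rightarrow> 'k d4 \<Rightarrow> 'k mat"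
  is tensor_term by (rule tensor_term_respects)

lemma tensor_act_gens:
  "tensor_act M N d4_a = tensor_term M N TA" "tensor_act M N d4_b = tensor_term M N TB"
  "tensor_act M N d4_c = tensor_term M N TC" "tensor_act M N d4_d = tensor_term M N TD"
  by (simp_all add: tensor_act.abs_eq d4_a_def d4_b_def d4_c_def d4_d_def)

lemmas tensor_act_simps = tensor_act_gens[unfolded tensor_term_simps]

lemma d4_rep_tensor: "d4_rep (mdim M * mdim N) (tensor_act M N)"
  unfolding d4_rep_def
  by (intro conjI allI; transfer) (simp_all add: tensor_term_simps)

definition module_tensor :: "'k::field d4_module \<Rightarrow> 'k d4_module \<Rightarrow> 'k d4_module" where
  "module_tensor M N = Abs_d4_module (mdim M * mdim N, tensor_act M N)"

definition module_unit :: "'k::field d4_module" where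
  "module_unit = Abs_d4_module (1, \<lambda>x. d4_counit x \<cdot>\<^sub>m 1\<^sub>m 1)"

lemma mdim_tensor [simp]: "mdim (module_tensor M N) = mdim M * mdim N"
  by (simp add: module_tensor_def mdim_Abs[OF d4_rep_tensor])

lemma act_tensor: "act (module_tensor M N) = tensor_act M N"
  by (simp add: module_tensor_def act_Abs[OF d4_rep_tensor])

lemma mdim_unit [simp]: "mdim module_unit = 1"
  by (simp only: module_unit_def mdim_Abs[OF d4_rep_counit])

lemma act_unit: "act module_unit x = d4_counit x \<cdot>\<^sub>m 1\<^sub>m 1"
  by (simp only: module_unit_def act_Abs[OF d4_rep_counit])

lemma module_tensor_assoc:
  fixes L M N :: "'k::field d4_module"
  shows "module_tensor (module_tensor L M) N = module_tensor L (module_tensor M N)"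
proof (rule d4_module_eqI)
  note [simp] = act_tensor tensor_act_simps act_1 mult.assoc kron_assoc
  show "mdim (module_tensor (module_tensor L M) N) = mdim (module_tensor L (module_tensor M N))"
    by simp
  have one: "tensor_act L M 1 = kron (1\<^sub>m (mdim L)) (1\<^sub>m (mdim M))"
    using act_1[of "module_tensor L M"] by simp
  have primitive: "kron (kron P Q + kron (1\<^sub>m (mdim L)) R) S + kron (kron (1\<^sub>m (mdim L)) (1\<^sub>m (mdim M))) T
      = kron P (kron Q S) + kron (1\<^sub>m (mdim L)) (kron R S + kron (1\<^sub>m (mdim M)) T)"
    if "P \<in> carrier_mat (mdim L) (mdim L)" "Q \<in> carrier_mat (mdim M) (mdim M)"
      "R \<in> carrier_mat (mdim M) (mdim M)" "S \<in> carrier_mat (mdim N) (mdim N)"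
      "T \<in> carrier_mat (mdim N) (mdim N)" for P Q R S T :: "'k mat"
  proof -
    let ?l = "mdim L" and ?m = "mdim M" and ?n = "mdim N"
    have "kron (kron P Q + kron (1\<^sub>m ?l) R) S = kron (kron P Q) S + kron (kron (1\<^sub>m ?l) R) S"
      by (rule kron_add_left[of _ "?l * ?m" "?l * ?m" _ _ ?n ?n]) (use that in simp_all)
    moreover have "kron (1\<^sub>m ?l) (kron R S + kron (1\<^sub>m ?m) T) =
        kron (1\<^sub>m ?l) (kron R S) + kron (1\<^sub>m ?l) (kron (1\<^sub>m ?m) T)"
      by (rule kron_add_right[of _ ?l ?l _ "?m * ?n" "?m * ?n"]) (use that in simp_all)
    moreover have "A + B + C = A + (B + C)"
      if "A \<in> carrier_mat n n" "B \<in> carrier_mat n n" "C \<in> carrier_mat n n" for A B C :: "'k mat" and n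
      using that by simp
    ultimately show ?thesis
      using that by (simp add: kron_assoc del: kron_one) (rule eq_matI, auto simp: add.assoc simp del: kron_one)
  qed
  show "act (module_tensor (module_tensor L M) N) d4_a = act (module_tensor L (module_tensor M N)) d4_a"
    "act (module_tensor (module_tensor L M) N) d4_d = act (module_tensor L (module_tensor M N)) d4_d"
    using primitive[OF act_carrier act_carrier act_carrier act_carrier act_carrier]
    by (simp_all only: act_tensor[of "module_tensor L M"] act_tensor[of L "module_tensor M N"]
        tensor_act_simps one act_1[of L] act_1[of M] act_tensor[of L M] act_tensor[of M N])
  show "act (module_tensor (module_tensor L M) N) d4_b = act (module_tensor L (module_tensor M N)) d4_b"
    "act (module_tensor (module_tensor L M) N) d4_c = act (module_tensor L (module_tensor M N)) d4_c"
    by simp_all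
qed

lemma one_smult_one: "1 \<cdot>\<^sub>m 1\<^sub>m n = (1\<^sub>m n :: 'k::semiring_1 mat)"
  by (auto intro!: eq_matI)

lemma zero_smult_one: "0 \<cdot>\<^sub>m 1\<^sub>m n = (0\<^sub>m n n :: 'k::semiring_1 mat)"
  by (auto intro!: eq_matI)

lemma module_tensor_unit_left: "module_tensor module_unit M = M"
proof (rule d4_module_eqI)
  have z: "0\<^sub>m (1 * mdim M) (1 * mdim M) + act M x = act M x" for x
    by (simp add: left_add_zero_mat[OF act_carrier])
  show "act (module_tensor module_unit M) d4_a = act M d4_a"
    "act (module_tensor module_unit M) d4_b = act M d4_b"
    "act (module_tensor module_unit M) d4_c = act M d4_c"
    "act (module_tensor module_unit M) d4_d = act M d4_d"
    by (simp_all only: act_tensor tensor_act_simps act_unit d4_counit_simps act_1 mdim_unit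
        one_smult_one zero_smult_one kron_one_left kron_zero_left dim_act z)
qed simp

lemma module_tensor_unit_right: "module_tensor M module_unit = M"
proof (rule d4_module_eqI)
  have z: "act M x + 0\<^sub>m (mdim M * 1) (mdim M * 1) = act M x" for x
    by (simp add: right_add_zero_mat[OF act_carrier])
  show "act (module_tensor M module_unit) d4_a = act M d4_a"
    "act (module_tensor M module_unit) d4_b = act M d4_b"
    "act (module_tensor M module_unit) d4_c = act M d4_c"
    "act (module_tensor M module_unit) d4_d = act M d4_d"
    by (simp_all only: act_tensor tensor_act_simps act_unit d4_counit_simps mdim_unit
        one_smult_one zero_smult_one kron_one_right kron_zero_right dim_act z)
qed simp

lemma d4_hom_tensor:
  assumes P: "d4_hom M M' P" and Q: "d4_hom N N' Q"
  shows "d4_hom (module_tensor M N) (module_tensor M' N') (kron P Q)"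
proof (rule d4_homI)
  let ?m = "mdim M" and ?n = "mdim N" and ?m' = "mdim M'" and ?n' = "mdim N'"
  note c = d4_hom_carrier[OF P] d4_hom_carrier[OF Q]
  show "kron P Q \<in> carrier_mat (mdim (module_tensor M' N')) (mdim (module_tensor M N))"
    using c by simp
  have single: "kron P Q * kron (act M u) (act N v) = kron (act M' u) (act N' v) * kron P Q" for u v
  proof -
    have "kron P Q * kron (act M u) (act N v) = kron (P * act M u) (Q * act N v)"
      by (rule kron_mult[OF c act_carrier act_carrier])
    also have "\<dots> = kron (act M' u * P) (act N' v * Q)"
      using P Q by (simp add: d4_hom_def)
    also have "\<dots> = kron (act M' u) (act N' v) * kron P Q"
      by (rule kron_mult[symmetric, OF act_carrier act_carrier c])
    finally show ?thesis .
  qed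
  have double: "kron P Q * (kron (act M u) (act N v) + kron (act M x) (act N y)) =
      (kron (act M' u) (act N' v) + kron (act M' x) (act N' y)) * kron P Q" for u v x y
    unfolding mult_add_distrib_mat[OF kron_carrier[OF c] kron_carrier[OF act_carrier act_carrier]
        kron_carrier[OF act_carrier act_carrier]]
      add_mult_distrib_mat[OF kron_carrier[OF act_carrier act_carrier]
        kron_carrier[OF act_carrier act_carrier] kron_carrier[OF c]]
      single ..
  show "kron P Q * act (module_tensor M N) d4_a = act (module_tensor M' N') d4_a * kron P Q"
    "kron P Q * act (module_tensor M N) d4_b = act (module_tensor M' N') d4_b * kron P Q"
    "kron P Q * act (module_tensor M N) d4_c = act (module_tensor M' N') d4_c * kron P Q"
    "kron P Q * act (module_tensor M N) d4_d = act (module_tensor M' N') d4_d * kron P Q"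
    by (simp_all only: act_tensor tensor_act_simps single double)
qed

lemma d4_iso_tensor:
  assumes "d4_iso M M'" "d4_iso N N'"
  shows "d4_iso (module_tensor M N) (module_tensor M' N')"
proof -
  from assms(1) obtain P P' where P: "d4_hom M M' P" "d4_hom M' M P'"
    and PP: "P * P' = 1\<^sub>m (mdim M')" "P' * P = 1\<^sub>m (mdim M)" by (auto simp: d4_iso_def)
  from assms(2) obtain Q Q' where Q: "d4_hom N N' Q" "d4_hom N' N Q'"
    and QQ: "Q * Q' = 1\<^sub>m (mdim N')" "Q' * Q = 1\<^sub>m (mdim N)" by (auto simp: d4_iso_def)
  note c = P[THEN d4_hom_carrier] Q[THEN d4_hom_carrier]
  have "kron P Q * kron P' Q' = 1\<^sub>m (mdim (module_tensor M' N'))"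
    unfolding kron_mult[OF c(1,3,2,4)] by (simp add: PP QQ)
  moreover have "kron P' Q' * kron P Q = 1\<^sub>m (mdim (module_tensor M N))"
    unfolding kron_mult[OF c(2,4,1,3)] by (simp add: PP QQ)
  ultimately show ?thesis
    unfolding d4_iso_def using d4_hom_tensor[OF P(1) Q(1)] d4_hom_tensor[OF P(2) Q(2)] by blast
qed

lemma biproduct_tensor_left:
  assumes E: "biproduct E M N i j p q"
  shows "biproduct (module_tensor L E) (module_tensor L M) (module_tensor L N)
    (kron (1\<^sub>m (mdim L)) i) (kron (1\<^sub>m (mdim L)) j) (kron (1\<^sub>m (mdim L)) p) (kron (1\<^sub>m (mdim L)) q)"
proof -
  have h: "d4_hom M E i" "d4_hom N E j" "d4_hom E M p" "d4_hom E N q"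
    using E by (auto simp: biproduct_def)
  note c = h[THEN d4_hom_carrier]
  have "kron (1\<^sub>m (mdim L)) (i * p) + kron (1\<^sub>m (mdim L)) (j * q) =
      kron (1\<^sub>m (mdim L)) (i * p + j * q)"
    by (rule kron_add_right[symmetric, OF one_carrier_mat mult_carrier_mat[OF c(1,3)]
          mult_carrier_mat[OF c(2,4)]])
  then show ?thesis
    using E h[THEN d4_hom_tensor[OF d4_hom_id[of L]]]
    by (simp add: biproduct_def kron_mult[OF one_carrier_mat c(1) one_carrier_mat c(3)]
        kron_mult[OF one_carrier_mat c(2) one_carrier_mat c(4)]
        kron_mult[OF one_carrier_mat c(3) one_carrier_mat c(1)]
        kron_mult[OF one_carrier_mat c(4) one_carrier_mat c(2)]
        kron_mult[OF one_carrier_mat c(3) one_carrier_mat c(2)]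
        kron_mult[OF one_carrier_mat c(4) one_carrier_mat c(1)])
qed

lemma biproduct_tensor_right:
  assumes E: "biproduct E M N i j p q"
  shows "biproduct (module_tensor E L) (module_tensor M L) (module_tensor N L)
    (kron i (1\<^sub>m (mdim L))) (kron j (1\<^sub>m (mdim L))) (kron p (1\<^sub>m (mdim L))) (kron q (1\<^sub>m (mdim L)))"
proof -
  have h: "d4_hom M E i" "d4_hom N E j" "d4_hom E M p" "d4_hom E N q"
    using E by (auto simp: biproduct_def)
  note c = h[THEN d4_hom_carrier]
  have "kron (i * p) (1\<^sub>m (mdim L)) + kron (j * q) (1\<^sub>m (mdim L)) =
      kron (i * p + j * q) (1\<^sub>m (mdim L))"
    by (rule kron_add_left[symmetric, OF mult_carrier_mat[OF c(1,3)]
          mult_carrier_mat[OF c(2,4)] one_carrier_mat])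
  then show ?thesis
    using E h[THEN d4_hom_tensor[OF _ d4_hom_id[of L]]]
    by (simp add: biproduct_def kron_mult[OF c(1) one_carrier_mat c(3) one_carrier_mat]
        kron_mult[OF c(2) one_carrier_mat c(4) one_carrier_mat]
        kron_mult[OF c(3) one_carrier_mat c(1) one_carrier_mat]
        kron_mult[OF c(4) one_carrier_mat c(2) one_carrier_mat]
        kron_mult[OF c(3) one_carrier_mat c(2) one_carrier_mat]
        kron_mult[OF c(4) one_carrier_mat c(1) one_carrier_mat])
qed

lemma module_tensor_sum_right:
  "d4_iso (module_tensor L (module_sum M N)) (module_sum (module_tensor L M) (module_tensor L N))"
  using biproduct_sum[of M N] biproduct_sum[of "module_tensor L M" "module_tensor L N"]
    biproduct_tensor_left biproduct_unique by metis

lemma module_tensor_sum_left: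
  "d4_iso (module_tensor (module_sum M N) L) (module_sum (module_tensor M L) (module_tensor N L))"
  using biproduct_sum[of M N] biproduct_sum[of "module_tensor M L" "module_tensor N L"]
    biproduct_tensor_right biproduct_unique by metis

section \<open>The Green ring\<close>

subsection \<open>Isomorphism classes\<close>

quotient_type (overloaded) 'k d4_class = "'k::field d4_module" / d4_iso
  by (intro equivpI reflpI sympI transpI) (auto intro: d4_iso_refl d4_iso_sym d4_iso_trans)

lift_definition class_sum :: "'k::field d4_class \<Rightarrow> 'k d4_class \<Rightarrow> 'k d4_class" is module_sum
  by (rule d4_iso_sum)

lift_definition class_tensor :: "'k::field d4_class \<Rightarrow> 'k d4_class \<Rightarrow> 'k d4_class" is module_tensor
  by (rule d4_iso_tensor)

lift_definition class_unit :: "'k::field d4_class" is module_unit .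

lemma class_tensor_assoc:
  "class_tensor (class_tensor c d) e = class_tensor c (class_tensor d e)"
  by transfer (simp add: module_tensor_assoc d4_iso_refl)

lemma class_tensor_unit_left: "class_tensor class_unit c = c"
  by transfer (simp add: module_tensor_unit_left d4_iso_refl)

lemma class_tensor_unit_right: "class_tensor c class_unit = c"
  by transfer (simp add: module_tensor_unit_right d4_iso_refl)

lemma class_tensor_sum_left:
  "class_tensor (class_sum c d) e = class_sum (class_tensor c e) (class_tensor d e)"
  by transfer (rule module_tensor_sum_left)

lemma class_tensor_sum_right:
  "class_tensor e (class_sum c d) = class_sum (class_tensor e c) (class_tensor e d)"
  by transfer (rule module_tensor_sum_right)

lemma right_inverse_dim_le:
  fixes P Q :: "'k::field mat"
  assumes P: "P \<in> carrier_mat n m" and Q: "Q \<in> carrier_mat m n" and PQ: "P * Q = 1\<^sub>m n"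
  shows "n \<le> m"
proof (rule ccontr)
  assume "\<not> n \<le> m"
  then have mn: "m < n" by simp
  define P' where "P' = mat n n (\<lambda>(i, j). if j < m then P $$ (i, j) else 0)"
  define Q' where "Q' = mat n n (\<lambda>(i, j). if i < m then Q $$ (i, j) else 0)"
  have c: "P' \<in> carrier_mat n n" "Q' \<in> carrier_mat n n" by (auto simp: P'_def Q'_def)
  have "P' * Q' = P * Q"
  proof (rule eq_matI)
    fix i j assume "i < dim_row (P * Q)" "j < dim_col (P * Q)"
    with P Q have ij: "i < n" "j < n" by auto
    have "(P' * Q') $$ (i, j) = (\<Sum>k\<in>{0..<n}. P' $$ (i, k) * Q' $$ (k, j))"
      using ij c by (simp add: scalar_prod_def)
    also have "\<dots> = (\<Sum>k\<in>{0..<m}. P' $$ (i, k) * Q' $$ (k, j))"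
      by (rule sum.mono_neutral_right) (use mn ij in \<open>auto simp: P'_def\<close>)
    also have "\<dots> = (\<Sum>k\<in>{0..<m}. P $$ (i, k) * Q $$ (k, j))"
      by (rule sum.cong) (use mn ij in \<open>auto simp: P'_def Q'_def\<close>)
    also have "\<dots> = (P * Q) $$ (i, j)"
      using ij P Q by (simp add: scalar_prod_def)
    finally show "(P' * Q') $$ (i, j) = (P * Q) $$ (i, j)" .
  qed (use P Q c in auto)
  then have "Q' * P' = 1\<^sub>m n"
    using mat_mult_left_right_inverse[OF c] PQ by simp
  then have "(Q' * P') $$ (m, m) = 1" using mn by simp
  moreover have "(Q' * P') $$ (m, m) = 0"
    using mn c by (simp add: scalar_prod_def) (simp add: Q'_def)
  ultimately show False by simp
qed

lift_definition class_dim :: "'k::field d4_class \<Rightarrow> nat" is mdim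
  unfolding d4_iso_def d4_hom_def by (meson right_inverse_dim_le le_antisym)

lemma class_dim_sum: "class_dim (class_sum c d) = class_dim c + class_dim d"
  by transfer simp

lemma class_dim_unit: "class_dim class_unit = 1"
  by transfer simp

subsection \<open>The ring\<close>

text \<open>
  The free abelian group on the isomorphism classes is \<^typ>\<open>'k::field d4_class \<Rightarrow>\<^sub>0 int\<close>, with
  \<^term>\<open>frag_of c\<close> as the generator given by \<^term>\<open>c\<close>; \<open>green_rel\<close> is the subgroup generated by the
  elements \<open>[M \<oplus> N] - [M] - [N]\<close>.
\<close>
inductive_set green_rel :: "('k::field d4_class \<Rightarrow>\<^sub>0 int) set" where
  gen: "frag_of (class_sum c d) - frag_of c - frag_of d \<in> green_rel"
| zero: "0 \<in> green_rel"
| diff: "x \<in> green_rel \<Longrightarrow> y \<in> green_rel \<Longrightarrow> x - y \<in> green_rel"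

definition green_eq :: "('k::field d4_class \<Rightarrow>\<^sub>0 int) \<Rightarrow> ('k d4_class \<Rightarrow>\<^sub>0 int) \<Rightarrow> bool" where
  "green_eq x y \<longleftrightarrow> x - y \<in> green_rel"

lemma green_rel_uminus: "x \<in> green_rel \<Longrightarrow> - x \<in> green_rel"
  using green_rel.diff[OF green_rel.zero, of x] by simp

lemma green_rel_add: "x \<in> green_rel \<Longrightarrow> y \<in> green_rel \<Longrightarrow> x + y \<in> green_rel"
  using green_rel.diff[OF _ green_rel_uminus, of x y] by simp

quotient_type (overloaded) 'k green_ring = "'k::field d4_class \<Rightarrow>\<^sub>0 int" / green_eq
proof (intro equivpI reflpI sympI transpI)
  show "green_eq x x" for x :: "'k d4_class \<Rightarrow>\<^sub>0 int"
    by (simp add: green_eq_def green_rel.zero)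
  show "green_eq y x" if "green_eq x y" for x y :: "'k d4_class \<Rightarrow>\<^sub>0 int"
    using green_rel_uminus[of "x - y"] that by (simp add: green_eq_def)
  show "green_eq x z" if "green_eq x y" "green_eq y z" for x y z :: "'k d4_class \<Rightarrow>\<^sub>0 int"
    using green_rel_add[of "x - y" "y - z"] that by (simp add: green_eq_def)
qed

definition tensor_frag ::
  "('k::field d4_class \<Rightarrow>\<^sub>0 int) \<Rightarrow> ('k d4_class \<Rightarrow>\<^sub>0 int) \<Rightarrow> ('k d4_class \<Rightarrow>\<^sub>0 int)" where
  "tensor_frag x y = frag_extend (\<lambda>c. frag_extend (\<lambda>d. frag_of (class_tensor c d)) y) x"

lemma tensor_frag_of [simp]: "tensor_frag (frag_of c) (frag_of d) = frag_of (class_tensor c d)"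
  by (simp add: tensor_frag_def)

lemma frag_cmul_diff: "frag_cmul k (a - b) = frag_cmul k a - frag_cmul k b"
  by (rule poly_mapping_eqI) (simp add: lookup_minus algebra_simps)

lemma frag_extend_fun_diff:
  "frag_extend (\<lambda>c. f c - g c) x = frag_extend f x - frag_extend g x"
  by (simp add: frag_extend_def frag_cmul_diff sum_subtractf)

lemma frag_extend_fun_0: "frag_extend (\<lambda>c. 0) x = 0"
  by (simp add: frag_extend_def)

lemma tensor_frag_diff_left: "tensor_frag (x - y) z = tensor_frag x z - tensor_frag y z"
  by (simp add: tensor_frag_def frag_extend_diff)

lemma tensor_frag_diff_right: "tensor_frag x (y - z) = tensor_frag x y - tensor_frag x z"
  by (simp add: tensor_frag_def frag_extend_diff frag_extend_fun_diff)

lemma tensor_frag_0 [simp]: "tensor_frag 0 x = 0" "tensor_frag x 0 = 0"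
  by (simp_all add: tensor_frag_def frag_extend_fun_0)

lemma tensor_frag_add_left: "tensor_frag (x + y) z = tensor_frag x z + tensor_frag y z"
  by (simp add: tensor_frag_def frag_extend_add)

lemma tensor_frag_add_right: "tensor_frag x (y + z) = tensor_frag x y + tensor_frag x z"
  using tensor_frag_diff_right[of x "y + z" z] by (simp add: algebra_simps)

lemma frag_induct [case_names zero one diff]:
  assumes "P 0" "\<And>c. P (frag_of c)" "\<And>x y. P x \<Longrightarrow> P y \<Longrightarrow> P (x - y)"
  shows "P x"
  by (rule frag_induction[of x UNIV]) (use assms in auto)

lemma tensor_frag_assoc: "tensor_frag (tensor_frag x y) z = tensor_frag x (tensor_frag y z)"
proof (induction x rule: frag_induct)
  case (one c)
  show ?case
  proof (induction y rule: frag_induct)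
    case (one d)
    show ?case
      by (induction z rule: frag_induct) (simp_all add: class_tensor_assoc tensor_frag_diff_right)
  qed (simp_all add: tensor_frag_diff_left tensor_frag_diff_right)
qed (simp_all add: tensor_frag_diff_left)

lemma tensor_frag_unit_left: "tensor_frag (frag_of class_unit) x = x"
  by (induction x rule: frag_induct) (simp_all add: class_tensor_unit_left tensor_frag_diff_right)

lemma tensor_frag_unit_right: "tensor_frag x (frag_of class_unit) = x"
  by (induction x rule: frag_induct) (simp_all add: class_tensor_unit_right tensor_frag_diff_left)

lemma tensor_frag_rel_left: "x \<in> green_rel \<Longrightarrow> tensor_frag x y \<in> green_rel"
proof (induction rule: green_rel.induct)
  case (gen c d)
  show ?case
  proof (induction y rule: frag_induct)
    case (one e)
    show ?case
      by (simp add: tensor_frag_diff_left class_tensor_sum_left green_rel.gen)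
  qed (simp_all add: tensor_frag_diff_right green_rel.zero green_rel.diff)
qed (simp_all add: tensor_frag_diff_left green_rel.zero green_rel.diff)

lemma tensor_frag_rel_right: "x \<in> green_rel \<Longrightarrow> tensor_frag y x \<in> green_rel"
proof (induction rule: green_rel.induct)
  case (gen c d)
  show ?case
  proof (induction y rule: frag_induct)
    case (one e)
    show ?case
      by (simp add: tensor_frag_diff_right class_tensor_sum_right green_rel.gen)
  qed (simp_all add: tensor_frag_diff_left green_rel.zero green_rel.diff)
qed (simp_all add: tensor_frag_diff_right green_rel.zero green_rel.diff)

lemma tensor_frag_respects:
  assumes "green_eq x x'" "green_eq y y'"
  shows "green_eq (tensor_frag x y) (tensor_frag x' y')"
proof -
  have "tensor_frag x y - tensor_frag x' y' = tensor_frag (x - x') y + tensor_frag x' (y - y')"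
    by (simp add: tensor_frag_diff_left tensor_frag_diff_right)
  then show ?thesis
    using assms
    by (simp add: green_eq_def green_rel_add tensor_frag_rel_left tensor_frag_rel_right)
qed

definition frag_dim :: "('k::field d4_class \<Rightarrow>\<^sub>0 int) \<Rightarrow> int" where
  "frag_dim x = Poly_Mapping.lookup (frag_extend (\<lambda>c. frag_cmul (int (class_dim c)) (frag_of ())) x) ()"

lemma frag_dim_of: "frag_dim (frag_of c) = int (class_dim c)"
  by (simp add: frag_dim_def)

lemma frag_dim_diff: "frag_dim (x - y) = frag_dim x - frag_dim y"
  by (simp add: frag_dim_def frag_extend_diff lookup_minus)

lemma frag_dim_rel: "x \<in> green_rel \<Longrightarrow> frag_dim x = 0"
proof (induction rule: green_rel.induct)
  case zero
  show ?case by (simp add: frag_dim_def)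
qed (simp_all add: frag_dim_diff frag_dim_of class_dim_sum)

instantiation green_ring :: (field) ring_1
begin

lift_definition zero_green_ring :: "'a green_ring" is 0 .
lift_definition one_green_ring :: "'a green_ring" is "frag_of class_unit" .
lift_definition plus_green_ring :: "'a green_ring \<Rightarrow> 'a green_ring \<Rightarrow> 'a green_ring" is "(+)"
  by (auto simp: green_eq_def add_diff_add intro: green_rel_add)
lift_definition uminus_green_ring :: "'a green_ring \<Rightarrow> 'a green_ring" is uminus
  by (auto simp: green_eq_def dest: green_rel_uminus)
lift_definition minus_green_ring :: "'a green_ring \<Rightarrow> 'a green_ring \<Rightarrow> 'a green_ring" is "(-)"
proof -
  fix x x' y y' :: "'a d4_class \<Rightarrow>\<^sub>0 int"
  assume "green_eq x x'" "green_eq y y'"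
  then have "(x - x') - (y - y') \<in> green_rel" by (simp add: green_eq_def green_rel.diff)
  then show "green_eq (x - y) (x' - y')" by (simp add: green_eq_def algebra_simps)
qed
lift_definition times_green_ring :: "'a green_ring \<Rightarrow> 'a green_ring \<Rightarrow> 'a green_ring"
  is tensor_frag by (rule tensor_frag_respects)

instance
proof
  have eqI: "green_eq x y" if "x = y" for x y :: "'a d4_class \<Rightarrow>\<^sub>0 int"
    using that by (simp add: green_eq_def green_rel.zero)
  fix x y z :: "'a green_ring"
  show "x + y + z = x + (y + z)" by transfer (rule eqI, simp add: add.assoc)
  show "x + y = y + x" by transfer (rule eqI, simp add: add.commute)
  show "0 + x = x" by transfer (rule eqI, simp)
  show "- x + x = 0" by transfer (rule eqI, simp)
  show "x - y = x + - y" by transfer (rule eqI, simp)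
  show "x * y * z = x * (y * z)" by transfer (rule eqI, rule tensor_frag_assoc)
  show "1 * x = x" by transfer (rule eqI, rule tensor_frag_unit_left)
  show "x * 1 = x" by transfer (rule eqI, rule tensor_frag_unit_right)
  show "(x + y) * z = x * z + y * z" by transfer (rule eqI, rule tensor_frag_add_left)
  show "x * (y + z) = x * y + x * z" by transfer (rule eqI, rule tensor_frag_add_right)
  show "(0 :: 'a green_ring) \<noteq> 1"
  proof
    assume "(0 :: 'a green_ring) = 1"
    then have "green_eq (0 :: 'a d4_class \<Rightarrow>\<^sub>0 int) (frag_of class_unit)" by transfer
    then have "frag_dim (0 - frag_of class_unit :: 'a d4_class \<Rightarrow>\<^sub>0 int) = 0"
      unfolding green_eq_def by (rule frag_dim_rel)
    moreover have "frag_dim (0 :: 'a d4_class \<Rightarrow>\<^sub>0 int) = 0"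
      by (rule frag_dim_rel[OF green_rel.zero])
    ultimately show False
      by (simp only: frag_dim_diff frag_dim_of class_dim_unit)
  qed
qed

end

lift_definition green_class :: "'k::field d4_module \<Rightarrow> 'k green_ring"
  is "\<lambda>M. frag_of (abs_d4_class M)" .

lemma green_class_iso: "d4_iso M N \<Longrightarrow> green_class M = green_class N"
  by (simp add: green_class_def d4_class.abs_eq_iff[THEN iffD2])

lemma green_class_sum: "green_class (module_sum M N) = green_class M + green_class N"
proof -
  have "green_eq (frag_of (class_sum c d)) (frag_of c + frag_of d)" for c d :: "'a d4_class"
    using green_rel.gen[of c d] by (simp add: green_eq_def diff_diff_eq)
  then show ?thesis
    by (simp add: green_class.abs_eq plus_green_ring.abs_eq green_ring.abs_eq_iff
        class_sum.abs_eq[symmetric])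
qed

lemma green_class_tensor: "green_class (module_tensor M N) = green_class M * green_class N"
  by (simp add: green_class.abs_eq times_green_ring.abs_eq class_tensor.abs_eq)

lemma green_class_unit: "green_class module_unit = 1"
  by (simp add: green_class.abs_eq one_green_ring.abs_eq class_unit.abs_eq)

definition finitely_generated_ring :: "('a, 'b) ring_scheme \<Rightarrow> bool" where
  "finitely_generated_ring R \<longleftrightarrow>
     (\<exists>S. finite S \<and> S \<subseteq> carrier R \<and> generate_ring R S = carrier R)"

end

theory Submission
  imports Defs
begin

text \<open>
  On the block \<open>b c = 1\<close> of a module \<open>M\<close> each \<open>x\<^sub>\<eta> = a + \<eta> d\<close> with \<open>\<eta> \<in> k\<close> squares to zero and is skew
  primitive, so by the Kuenneth formula the dimension of its homology, read in \<open>k\<close>, is a ring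
  homomorphism \<open>\<Phi>\<^sub>\<eta>\<close> from the Green ring to \<open>k\<close>; the block \<open>b c = -1\<close> does not contribute because
  its tensor square is acyclic. The rank of \<open>x\<^sub>\<eta>\<close> on a given module is the same for all but finitely
  many \<open>\<eta>\<close>, so on finitely many generators, and hence on the subring they generate, \<open>\<Phi>\<^sub>\<eta>\<close> and \<open>\<Phi>\<^sub>\<theta>\<close>
  agree for some \<open>\<eta> \<noteq> \<theta>\<close>. But there is a two-dimensional module with \<open>\<Phi>\<^sub>\<eta> = 2 \<noteq> 0\<close> and \<open>\<Phi>\<^sub>\<theta> = 0\<close>.
\<close>

section \<open>Traces and generalized inverses\<close>

definition mat_trace :: "'a::comm_monoid_add mat \<Rightarrow> 'a" where
  "mat_trace A = (\<Sum>i<dim_row A. A $$ (i, i))"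

lemma mat_trace_add:
  "A \<in> carrier_mat n n \<Longrightarrow> B \<in> carrier_mat n n \<Longrightarrow> mat_trace (A + B) = mat_trace A + mat_trace B"
  by (auto simp: mat_trace_def sum.distrib)

lemma mat_trace_smult: "A \<in> carrier_mat n n \<Longrightarrow> mat_trace (c \<cdot>\<^sub>m A) = c * mat_trace A"
  for A :: "'a::comm_ring_1 mat"
  by (auto simp: mat_trace_def sum_distrib_left)

lemma mat_trace_comm:
  fixes A :: "'a::comm_ring_1 mat"
  assumes "A \<in> carrier_mat n m" "B \<in> carrier_mat m n"
  shows "mat_trace (A * B) = mat_trace (B * A)"
proof -
  have "mat_trace (A * B) = (\<Sum>i<n. \<Sum>j<m. A $$ (i, j) * B $$ (j, i))"
    using assms by (auto simp: mat_trace_def scalar_prod_def lessThan_atLeast0 intro!: sum.cong)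
  also have "\<dots> = (\<Sum>j<m. \<Sum>i<n. A $$ (i, j) * B $$ (j, i))"
    by (rule sum.swap)
  also have "\<dots> = mat_trace (B * A)"
    using assms by (auto simp: mat_trace_def scalar_prod_def lessThan_atLeast0 mult.commute intro!: sum.cong)
  finally show ?thesis .
qed

lemma mat_trace_block_sum:
  assumes "A \<in> carrier_mat m m" "B \<in> carrier_mat n n"
  shows "mat_trace (block_sum A B) = mat_trace A + mat_trace B"
proof -
  have "mat_trace (block_sum A B) = (\<Sum>i<m + n. block_sum A B $$ (i, i))"
    using assms by (simp add: mat_trace_def block_sum_def)
  also have "\<dots> = (\<Sum>i<m. block_sum A B $$ (i, i)) + (\<Sum>i<n. block_sum A B $$ (m + i, m + i))"
    using sum.atLeastLessThan_concat[of 0 m "m + n" "\<lambda>i. block_sum A B $$ (i, i)"]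
      sum.shift_bounds_nat_ivl[of "\<lambda>i. block_sum A B $$ (i, i)" 0 m n]
    by (simp add: lessThan_atLeast0 add.commute)
  also have "\<dots> = mat_trace A + mat_trace B"
    using assms by (simp add: mat_trace_def block_sum_def)
  finally show ?thesis .
qed

lemma mat_trace_kron:
  fixes A :: "'a::comm_semiring_1 mat"
  assumes "A \<in> carrier_mat m m" "B \<in> carrier_mat n n"
  shows "mat_trace (kron A B) = mat_trace A * mat_trace B"
proof -
  have "mat_trace (kron A B) = (\<Sum>k\<in>{0..<m * n}. A $$ (k div n, k div n) * B $$ (k mod n, k mod n))"
    using assms by (auto simp: mat_trace_def index_kron lessThan_atLeast0 intro!: sum.cong)
  also have "\<dots> = (\<Sum>i\<in>{0..<m}. \<Sum>j\<in>{0..<n}. A $$ (i, i) * B $$ (j, j))"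
    by (rule sum_div_mod)
  also have "\<dots> = mat_trace A * mat_trace B"
    using assms by (simp add: mat_trace_def sum_product lessThan_atLeast0)
  finally show ?thesis .
qed

text \<open>
  Wedderburn's rank reduction, cleared of denominators so that it also applies over \<open>k[t]\<close>: for a
  matrix unit \<open>E\<close> picking a nonzero entry \<open>p\<close> of \<open>Y\<close>, the matrix \<open>p Y - Y E Y\<close> has rank one less.
\<close>
lemma rank_reduction_step:
  fixes Y :: "'a::comm_ring_1 mat"
  assumes Y: "Y \<in> carrier_mat n n" and E: "E \<in> carrier_mat n n" and N: "N \<in> carrier_mat n n"
    and EYE: "E * Y * E = p \<cdot>\<^sub>m E" and tr: "mat_trace (Y * E) = p"
  defines "Y' \<equiv> p \<cdot>\<^sub>m Y - Y * E * Y"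
  assumes ind: "Y' * N * Y' = q \<cdot>\<^sub>m Y'" "mat_trace (Y' * N) = r * q"
  shows "\<exists>M \<in> carrier_mat n n. Y * M * Y = (q * p) \<cdot>\<^sub>m Y \<and> mat_trace (Y * M) = (r + 1) * (q * p)"
proof -
  \<comment> \<open>\<open>Y * E\<close> and \<open>E * Y\<close> square to \<open>p\<close> times
    themselves, so up to the factor \<open>p\<close> the matrices \<open>L\<close> and
    \<open>R\<close> are the complementary projections. They satisfy
    \<open>L * Y = Y * R = Y'\<close>.\<close>
  define L where "L = p \<cdot>\<^sub>m 1\<^sub>m n - Y * E"
  define R where "R = p \<cdot>\<^sub>m 1\<^sub>m n - E * Y"
  have Y': "Y' \<in> carrier_mat n n"
    unfolding Y'_def by (rule minus_carrier_mat[OF mult_carrier_mat[OF mult_carrier_mat[OF Y E] Y]])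
  have L: "L \<in> carrier_mat n n" and R: "R \<in> carrier_mat n n" using Y E by (auto simp: L_def R_def)
  note mm = assoc_mult_mat[of _ n n _ n _ n] add_mult_distrib_mat[of _ n n _ _ n]
    mult_add_distrib_mat[of _ n n _ n] minus_mult_distrib_mat[of _ n n _ _ n]
    mult_minus_distrib_mat[of _ n n _ n] mult_smult_assoc_mat[of _ n n _ n]
    mult_smult_distrib[of _ n n _ n]
  have EYE': "E * (Y * E) = p \<cdot>\<^sub>m E" using EYE Y E by (simp add: mm)
  have EYEY: "E * (Y * (E * Y)) = p \<cdot>\<^sub>m (E * Y)"
    using arg_cong[OF EYE, of "\<lambda>A. A * Y"] Y E by (simp add: mm)
  have LY: "L * Y = Y'" "Y * R = Y'"
    using Y E by (simp_all add: L_def R_def Y'_def mm)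
  have EY': "E * Y' = 0\<^sub>m n n" using Y E by (simp add: Y'_def mm EYEY)
  have LY': "L * Y' = p \<cdot>\<^sub>m Y'" 
    using Y E Y' by (simp add: L_def mm EY') (auto intro!: eq_matI)
  \<comment> \<open>After multiplication by \<open>Y\<close> on both sides, the first summand
    contributes \<open>Y' * N * Y' = q Y'\<close> and the second \<open>q (Y * E * Y)\<close>. By
    the definition of \<open>Y'\<close> these add up to \<open>q p Y\<close>.\<close>
  define M where "M = R * N * L + q \<cdot>\<^sub>m E"
  have M: "M \<in> carrier_mat n n" using N L R E by (simp add: M_def)
  have "Y * M * Y = (Y * R) * N * (L * Y) + q \<cdot>\<^sub>m (Y * E * Y)"
    using Y E N L R by (simp add: M_def mm)
  also have "\<dots> = q \<cdot>\<^sub>m Y' + q \<cdot>\<^sub>m (Y * E * Y)" by (simp add: LY ind)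
  also have "\<dots> = (q * p) \<cdot>\<^sub>m Y"
    by (rule eq_matI) (use Y E in \<open>auto simp: Y'_def algebra_simps\<close>)
  finally have 1: "Y * M * Y = (q * p) \<cdot>\<^sub>m Y" .
  have "Y * M = (Y * R) * N * L + q \<cdot>\<^sub>m (Y * E)"
    using Y E N L R by (simp add: M_def mm)
  then have "mat_trace (Y * M) = mat_trace (Y' * N * L) + q * p"
    using Y E N L R Y' by (simp add: LY mat_trace_add[of _ n] mat_trace_smult[of _ n] tr)
  \<comment> \<open>Cyclicity brings \<open>L\<close> to the left of \<open>Y'\<close>, where it
    acts as the scalar \<open>p\<close>.\<close>
  also have "mat_trace (Y' * N * L) = mat_trace (L * (Y' * N))"
    using Y' N L by (intro mat_trace_comm[of _ n n]) auto
  also have "L * (Y' * N) = p \<cdot>\<^sub>m (Y' * N)"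
    using arg_cong[OF LY', of "\<lambda>A. A * N"] Y' N L by (simp add: mm)
  also have "mat_trace \<dots> = p * (r * q)" using Y' N by (simp add: mat_trace_smult[of _ n] ind)
  finally have "mat_trace (Y * M) = (r + 1) * (q * p)" by (simp add: algebra_simps)
  with 1 M show ?thesis by blast
qed

text \<open>\<open>E\<close> is the matrix unit with the indices of the chosen entry transposed.
  With the pivot \<open>p = Y $$ (i, j)\<close> this provides the hypotheses of
  \<open>rank_reduction_step\<close>.\<close>

lemma matrix_unit_sandwich:
  fixes Y :: "'a::comm_ring_1 mat"
  assumes Y: "Y \<in> carrier_mat n n" and ij: "i < n" "j < n"
  defines "E \<equiv> mat n n (\<lambda>(k, l). if k = j \<and> l = i then 1 else 0)"
  shows "E * Y * E = (Y $$ (i, j)) \<cdot>\<^sub>m E" and "mat_trace (Y * E) = Y $$ (i, j)"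
    and "k < n \<Longrightarrow> l < n \<Longrightarrow> (Y * E * Y) $$ (k, l) = Y $$ (k, j) * Y $$ (i, l)"
proof -
  have E: "E \<in> carrier_mat n n" by (simp add: E_def)
  have ye: "(A * E) $$ (k, l) = (if l = i then A $$ (k, j) else 0)" if "A \<in> carrier_mat n n" "k < n" "l < n" for A k l
    using that ij by (auto simp: E_def scalar_prod_def if_distrib[of "\<lambda>x. _ * x"] cong: if_cong)
  have ey: "(E * A) $$ (k, l) = (if k = j then A $$ (i, l) else 0)" if "A \<in> carrier_mat n n" "k < n" "l < n" for A k l
    using that ij by (auto simp: E_def scalar_prod_def if_distrib[of "\<lambda>x. x * _"] cong: if_cong)
  show "E * Y * E = (Y $$ (i, j)) \<cdot>\<^sub>m E"
    by (rule eq_matI) (use E Y ij in \<open>auto simp: ye ey mult_carrier_mat[OF E Y] simp del: index_mult_mat(1),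
        auto simp: E_def\<close>)
  show "mat_trace (Y * E) = Y $$ (i, j)"
    using E Y ij by (simp add: mat_trace_def ye del: index_mult_mat(1))
  show "(Y * E * Y) $$ (k, l) = Y $$ (k, j) * Y $$ (i, l)" if "k < n" "l < n"
  proof -
    have "Y * E * Y = Y * (E * Y)" using E Y by (simp add: assoc_mult_mat[of _ n n _ n _ n])
    also have "\<dots> $$ (k, l) = (\<Sum>m\<in>{0..<n}. Y $$ (k, m) * (E * Y) $$ (m, l))"
      using E Y that by (simp add: scalar_prod_def)
    also have "\<dots> = Y $$ (k, j) * Y $$ (i, l)"
      using that ij by (simp add: ey[OF Y] if_distrib[of "\<lambda>x. _ * x"] cong: if_cong)
    finally show ?thesis .
  qed
qed

text \<open>Over the fraction field, \<open>N / q\<close> is a generalized inverse of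
  \<open>Y\<close>, and \<open>r\<close> counts the reduction steps, so it is the rank. The
  induction is on the number of nonzero rows: a reduction clears the pivot row and keeps zero rows
  zero. Keeping \<open>q\<close> as a separate factor allows specialization wherever
  \<open>q\<close> does not vanish.\<close>

lemma generalized_inverse_domain:
  fixes Y :: "'a::idom mat"
  assumes "Y \<in> carrier_mat n n"
  shows "\<exists>N q r. N \<in> carrier_mat n n \<and> q \<noteq> 0 \<and> Y * N * Y = q \<cdot>\<^sub>m Y \<and> mat_trace (Y * N) = of_nat r * q"
  using assms
proof (induction "card {i. i < n \<and> (\<exists>j<n. Y $$ (i, j) \<noteq> 0)}" arbitrary: Y rule: less_induct)
  case less
  note Y = less.prems
  show ?case
  proof (cases "\<exists>i<n. \<exists>j<n. Y $$ (i, j) \<noteq> 0")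
    case False
    then have "Y = 0\<^sub>m n n" using Y by (intro eq_matI) auto
    then show ?thesis
      by (intro exI[of _ "0\<^sub>m n n"] exI[of _ 1] exI[of _ 0]) (auto simp: mat_trace_def)
  next
    case True
    then obtain i j where ij: "i < n" "j < n" and nz: "Y $$ (i, j) \<noteq> 0" by auto
    define p where "p = Y $$ (i, j)"
    define E :: "'a mat" where "E = mat n n (\<lambda>(k, l). if k = j \<and> l = i then 1 else 0)"
    have E: "E \<in> carrier_mat n n" by (simp add: E_def)
    note unit = matrix_unit_sandwich[OF Y ij, folded E_def p_def]
    define Y' where "Y' = p \<cdot>\<^sub>m Y - Y * E * Y"
    have Y': "Y' \<in> carrier_mat n n"
    unfolding Y'_def by (rule minus_carrier_mat[OF mult_carrier_mat[OF mult_carrier_mat[OF Y E] Y]])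
    have ent: "Y' $$ (k, l) = p * Y $$ (k, l) - Y $$ (k, j) * Y $$ (i, l)" if "k < n" "l < n" for k l
      using unit(3)[OF that] that Y E by (simp add: Y'_def del: index_mult_mat(1))
    have "{k. k < n \<and> (\<exists>l<n. Y' $$ (k, l) \<noteq> 0)} \<subset> {k. k < n \<and> (\<exists>l<n. Y $$ (k, l) \<noteq> 0)}"
    proof
      show "{k. k < n \<and> (\<exists>l<n. Y' $$ (k, l) \<noteq> 0)} \<subseteq> {k. k < n \<and> (\<exists>l<n. Y $$ (k, l) \<noteq> 0)}"
      proof clarify
        fix k l assume kl: "k < n" "l < n" and "Y' $$ (k, l) \<noteq> 0"
        then have "Y $$ (k, l) \<noteq> 0 \<or> Y $$ (k, j) \<noteq> 0" using ent[OF kl] by auto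
        then show "\<exists>l<n. Y $$ (k, l) \<noteq> 0" using kl ij by blast
      qed
      have "i \<notin> {k. k < n \<and> (\<exists>l<n. Y' $$ (k, l) \<noteq> 0)}"
        using ent ij by (auto simp: p_def)
      then show "{k. k < n \<and> (\<exists>l<n. Y' $$ (k, l) \<noteq> 0)} \<noteq> {k. k < n \<and> (\<exists>l<n. Y $$ (k, l) \<noteq> 0)}"
        using ij nz by blast
    qed
    then have "card {k. k < n \<and> (\<exists>l<n. Y' $$ (k, l) \<noteq> 0)} < card {k. k < n \<and> (\<exists>l<n. Y $$ (k, l) \<noteq> 0)}"
      by (intro psubset_card_mono) auto
    from less.hyps[OF this Y'] obtain N q r where N: "N \<in> carrier_mat n n" and q: "q \<noteq> 0"
      and "Y' * N * Y' = q \<cdot>\<^sub>m Y'" "mat_trace (Y' * N) = of_nat r * q" by blast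
    from rank_reduction_step[OF Y E N unit(1,2) this(3,4)[unfolded Y'_def]]
    obtain M where "M \<in> carrier_mat n n" "Y * M * Y = (q * p) \<cdot>\<^sub>m Y"
      "mat_trace (Y * M) = (of_nat r + 1) * (q * p)" by blast
    then show ?thesis using q nz
      by (intro exI[of _ M] exI[of _ "q * p"] exI[of _ "Suc r"]) (auto simp: p_def add.commute)
  qed
qed

section \<open>The block idempotents of \<open>D\<^sub>4\<close>\<close>

text \<open>
  \<open>b c\<close> is central with square \<open>1\<close>. On the block \<open>b c = 1\<close> every \<open>a + \<eta> d\<close> squares to zero, while the
  block \<open>b c = -1\<close> is a Clifford algebra on which \<open>d / 2\<close> is a contracting homotopy for \<open>a + \<eta> d\<close>.
\<close>
definition d4_even :: "'k::field d4" where
  "d4_even = d4_scal (1 / 2) * (1 + d4_b * d4_c)"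

definition d4_odd :: "'k::field d4" where
  "d4_odd = d4_scal (1 / 2) * (1 - d4_b * d4_c)"

definition d4_lin :: "'k::field \<Rightarrow> 'k d4" where
  "d4_lin \<eta> = d4_a + d4_scal \<eta> * d4_d"

text \<open>Rewrite rules that sort monomials into the order \<open>a\<close>, \<open>d\<close>,
  \<open>b\<close>, \<open>c\<close>. Each rule has a second form with a tail \<open>z\<close>, for
  use inside products nested to the right.\<close>

lemma d4_flip:
  fixes z :: "'k::field d4"
  shows "d4_b * d4_a = - (d4_a * d4_b :: 'k d4)" "d4_b * (d4_a * z) = - (d4_a * (d4_b * z))"
    "d4_c * d4_a = - (d4_a * d4_c :: 'k d4)" "d4_c * (d4_a * z) = - (d4_a * (d4_c * z))"
    "d4_b * d4_d = - (d4_d * d4_b :: 'k d4)" "d4_b * (d4_d * z) = - (d4_d * (d4_b * z))"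
    "d4_c * d4_d = - (d4_d * d4_c :: 'k d4)" "d4_c * (d4_d * z) = - (d4_d * (d4_c * z))"
    "d4_c * d4_b = (d4_b * d4_c :: 'k d4)" "d4_c * (d4_b * z) = d4_b * (d4_c * z)"
    "d4_a * d4_a = (0 :: 'k d4)" "d4_a * (d4_a * z) = 0"
    "d4_d * d4_d = (0 :: 'k d4)" "d4_d * (d4_d * z) = 0"
    "d4_b * d4_b = (1 :: 'k d4)" "d4_b * (d4_b * z) = z"
    "d4_c * d4_c = (1 :: 'k d4)" "d4_c * (d4_c * z) = z"
    "d4_d * d4_a = (1 - d4_b * d4_c - d4_a * d4_d :: 'k d4)"
    "d4_d * (d4_a * z) = z - d4_b * (d4_c * z) - d4_a * (d4_d * z)"
proof -
  note r = d4_relations(1-4,6-9) d4_cb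
  show "d4_b * d4_a = - (d4_a * d4_b :: 'k d4)" "d4_c * d4_a = - (d4_a * d4_c :: 'k d4)"
    "d4_b * d4_d = - (d4_d * d4_b :: 'k d4)" "d4_c * d4_d = - (d4_d * d4_c :: 'k d4)"
    "d4_c * d4_b = (d4_b * d4_c :: 'k d4)" "d4_a * d4_a = (0 :: 'k d4)" "d4_d * d4_d = (0 :: 'k d4)"
    "d4_b * d4_b = (1 :: 'k d4)" "d4_c * d4_c = (1 :: 'k d4)"
    by (simp_all add: r)
  show "d4_d * d4_a = (1 - d4_b * d4_c - d4_a * d4_d :: 'k d4)"
    by (simp add: d4_da algebra_simps)
  then have "(d4_d * d4_a) * z = (1 - d4_b * d4_c - d4_a * d4_d) * z" by simp
  then show "d4_d * (d4_a * z) = z - d4_b * (d4_c * z) - d4_a * (d4_d * z)"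
    by (simp add: algebra_simps)
  show "d4_b * (d4_a * z) = - (d4_a * (d4_b * z))" "d4_c * (d4_a * z) = - (d4_a * (d4_c * z))"
    "d4_b * (d4_d * z) = - (d4_d * (d4_b * z))" "d4_c * (d4_d * z) = - (d4_d * (d4_c * z))"
    "d4_c * (d4_b * z) = d4_b * (d4_c * z)" "d4_a * (d4_a * z) = 0" "d4_d * (d4_d * z) = 0"
    "d4_b * (d4_b * z) = z" "d4_c * (d4_c * z) = z"
    by (simp_all add: r flip: mult.assoc)
qed

lemma d4_scal_left: "x * (d4_scal r * y) = d4_scal r * (x * y)"
  by (metis d4_scal_central mult.assoc)

text \<open>Scalars move to the front past generators only; the unrestricted rules would exchange
  two scalars forever.\<close>

lemmas d4_scal_move =
  d4_scal_central[symmetric, of d4_a] d4_scal_central[symmetric, of d4_b]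
  d4_scal_central[symmetric, of d4_c] d4_scal_central[symmetric, of d4_d]
  d4_scal_left[of d4_a] d4_scal_left[of d4_b] d4_scal_left[of d4_c] d4_scal_left[of d4_d]

lemma d4_scal_scal:
  "d4_scal r * d4_scal s = d4_scal (r * s)" "d4_scal r * (d4_scal s * y) = d4_scal (r * s) * y"
  by (simp_all add: d4_scal_mult mult.assoc)

lemma d4_scal_half_add:
  assumes "(2 :: 'k::field) \<noteq> 0"
  shows "d4_scal (1 / 2 :: 'k) + d4_scal (1 / 2) = 1"
    "d4_scal (1 / 2 :: 'k) + (d4_scal (1 / 2) + y) = 1 + y"
    "d4_scal (1 / 2 :: 'k) * x + d4_scal (1 / 2) * x = x"
    "d4_scal (1 / 2 :: 'k) * x + (d4_scal (1 / 2) * x + y) = x + y"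
proof -
  have "(1 / 2 + 1 / 2 :: 'k) = 1" using assms by (simp add: field_simps)
  then have h: "d4_scal (1 / 2 :: 'k) + d4_scal (1 / 2) = 1" 
    by (metis d4_scal_add d4_scal_1)
  show "d4_scal (1 / 2 :: 'k) + d4_scal (1 / 2) = 1"
    "d4_scal (1 / 2 :: 'k) + (d4_scal (1 / 2) + y) = 1 + y"
    "d4_scal (1 / 2 :: 'k) * x + d4_scal (1 / 2) * x = x"
    "d4_scal (1 / 2 :: 'k) * x + (d4_scal (1 / 2) * x + y) = x + y"
    using h by (simp_all flip: add.assoc semiring_class.distrib_right)
qed

text \<open>Quarters arise from products of two block idempotents, each of which carries a factor
  \<open>1 / 2\<close>.\<close>

lemma d4_scal_quarter_add:
  assumes "(2 :: 'k::field) \<noteq> 0"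
  shows "d4_scal (1 / 4 :: 'k) + d4_scal (1 / 4) = d4_scal (1 / 2)"
    "d4_scal (1 / 4 :: 'k) + (d4_scal (1 / 4) + y) = d4_scal (1 / 2) + y"
    "d4_scal (1 / 4 :: 'k) * x + d4_scal (1 / 4) * x = d4_scal (1 / 2) * x"
    "d4_scal (1 / 4 :: 'k) * x + (d4_scal (1 / 4) * x + y) = d4_scal (1 / 2) * x + y"
proof -
  have "(4 :: 'k) = 2 * 2" by simp
  then have "(1 / 4 + 1 / 4 :: 'k) = 1 / 2" using assms by (metis add_divide_distrib one_add_one
      divide_divide_eq_left div_self)
  then have h: "d4_scal (1 / 4 :: 'k) + d4_scal (1 / 4) = d4_scal (1 / 2)"
    by (metis d4_scal_add)
  show "d4_scal (1 / 4 :: 'k) + d4_scal (1 / 4) = d4_scal (1 / 2)"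
    "d4_scal (1 / 4 :: 'k) + (d4_scal (1 / 4) + y) = d4_scal (1 / 2) + y"
    "d4_scal (1 / 4 :: 'k) * x + d4_scal (1 / 4) * x = d4_scal (1 / 2) * x"
    "d4_scal (1 / 4 :: 'k) * x + (d4_scal (1 / 4) * x + y) = d4_scal (1 / 2) * x + y"
    using h by (simp_all flip: add.assoc semiring_class.distrib_right)
qed

lemmas d4_norm = d4_flip d4_scal_move d4_scal_scal algebra_simps d4_scal_half_add d4_scal_quarter_add

text \<open>\<open>a\<close> and \<open>d\<close> anticommute with both \<open>b\<close> and
  \<open>c\<close>, so the two signs cancel in \<open>b c\<close>.\<close>

lemma d4_even_central: "d4_even * x = x * d4_even"
proof (induction x rule: d4_induct)
  case (mult x y)
  then show ?case by (metis mult.assoc)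
qed (simp_all add: d4_even_def d4_norm)

lemma d4_odd_central: "d4_odd * x = x * d4_odd"
proof (induction x rule: d4_induct)
  case (mult x y)
  then show ?case by (metis mult.assoc)
qed (simp_all add: d4_odd_def d4_norm)

lemma d4_even_odd:
  assumes "(2 :: 'k::field) \<noteq> 0"
  shows "d4_even * d4_even = (d4_even :: 'k d4)" "d4_odd * d4_odd = (d4_odd :: 'k d4)"
    "d4_even * d4_odd = (0 :: 'k d4)" "d4_odd * d4_even = (0 :: 'k d4)"
    "d4_even + d4_odd = (1 :: 'k d4)"
  using assms by (simp_all add: d4_even_def d4_odd_def d4_norm)

text \<open>Since \<open>b\<close> and \<open>c\<close> are involutions, they agree where
  \<open>b c = 1\<close>. There the comultiplication twists \<open>a\<close> and \<open>d\<close> by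
  the same element, which makes \<open>d4_lin \<eta>\<close> skew primitive.\<close>

lemma d4_even_c: "d4_c * d4_even = (d4_b * d4_even :: 'k::field d4)"
  by (simp add: d4_even_def d4_norm)

text \<open>The square of \<open>a + \<eta> d\<close> is
  \<open>\<eta> (d a + a d) = \<eta> (1 - b c)\<close>, which the even idempotent kills.\<close>

lemma d4_lin_square: "d4_even * (d4_lin \<eta> * d4_lin \<eta>) = 0"
  by (simp add: d4_even_def d4_lin_def d4_norm)

text \<open>As \<open>d\<close> squares to zero, its anticommutator with \<open>a + \<eta> d\<close>
  is \<open>d a + a d = 1 - b c\<close> for every \<open>\<eta>\<close>, and this equals
  \<open>2\<close> on the odd block.\<close>

lemma d4_odd_homotopy: 
  assumes "(2 :: 'k::field) \<noteq> 0"
  shows "d4_scal (1 / 2) * (d4_lin \<eta> * (d4_odd * d4_d) + d4_odd * d4_d * d4_lin \<eta>) = (d4_odd :: 'k d4)"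
  using assms by (simp add: d4_odd_def d4_lin_def d4_norm)

section \<open>Homology of square-zero matrices\<close>

text \<open>
  \<open>p\<close> projects the image of \<open>e\<close> onto the homology of \<open>x\<close>, and \<open>s\<close> is a homotopy from \<open>p\<close> to the identity.
\<close>
definition homology_data :: "nat \<Rightarrow> 'a::ring_1 mat \<Rightarrow> 'a mat \<Rightarrow> 'a mat \<Rightarrow> 'a mat \<Rightarrow> bool" where
  "homology_data n e x s p \<longleftrightarrow> s \<in> carrier_mat n n \<and> p \<in> carrier_mat n n \<and>
     e * s = s \<and> s * e = s \<and> e * p = p \<and> p * e = p \<and>
     x * p = 0\<^sub>m n n \<and> p * x = 0\<^sub>m n n \<and> p + (x * s + s * x) = e"

text \<open>Both traces equal that of \<open>p * p'\<close>. In
  \<open>p = p * (p' + x * s' + s' * x)\<close> the first homotopy term vanishes by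
  \<open>p * x = 0\<close>, and the second has trace zero by cyclicity and
  \<open>x * p = 0\<close>.\<close>

lemma homology_data_trace_unique:
  fixes x :: "'a::comm_ring_1 mat"
  assumes x: "x \<in> carrier_mat n n" and 1: "homology_data n e x s p" and 2: "homology_data n e x s' p'"
  shows "mat_trace p = mat_trace p'"
proof -
  note mm = assoc_mult_mat[of _ n n _ n _ n] add_mult_distrib_mat[of _ n n _ _ n]
    mult_add_distrib_mat[of _ n n _ n]
  have main: "mat_trace p = mat_trace (p * p')"
    if 1: "homology_data n e x s p" and 2: "homology_data n e x s' p'" for s p s' p'
  proof -
    have c: "s \<in> carrier_mat n n" "p \<in> carrier_mat n n" "s' \<in> carrier_mat n n" "p' \<in> carrier_mat n n"
      using 1 2 by (auto simp: homology_data_def)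
    have px: "p * x = 0\<^sub>m n n" "x * p = 0\<^sub>m n n" using 1 by (auto simp: homology_data_def)
    have "p = p * (p' + (x * s' + s' * x))" using 1 2 by (simp add: homology_data_def)
    also have "\<dots> = p * p' + ((p * x) * s' + p * (s' * x))" using c x by (simp add: mm)
    also have "\<dots> = p * p' + p * (s' * x)" using c x by (simp add: px)
    finally have "mat_trace p = mat_trace (p * p' + p * (s' * x))" by simp
    also have "\<dots> = mat_trace (p * p') + mat_trace (p * (s' * x))"
      using c x by (simp add: mat_trace_add[of _ n])
    also have "mat_trace (p * (s' * x)) = mat_trace (s' * (x * p))"
      using c x mat_trace_comm[of p n n "s' * x"] by (simp add: mm)
    also have "\<dots> = 0" using c by (simp add: px mat_trace_def)
    finally show ?thesis by simp
  qed
  have "mat_trace (p * p') = mat_trace (p' * p)"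
    using 1 2 by (intro mat_trace_comm[of _ n n]) (auto simp: homology_data_def)
  then show ?thesis using main[OF 1 2] main[OF 2 1] by simp
qed

text \<open>\<open>N\<close> is a generalized inverse of \<open>e * x\<close>; its compression
  \<open>s = e * N * e\<close> serves as the homotopy, and \<open>p\<close> is what remains of
  \<open>e\<close>. Both \<open>x * s\<close> and \<open>s * x\<close> have the trace of
  \<open>(e * x) * N\<close>, in accordance with the dimension of homology being the total dimension
  minus twice the rank.\<close>

lemma homology_data_exists:
  fixes x :: "'a::comm_ring_1 mat"
  assumes c: "e \<in> carrier_mat n n" "x \<in> carrier_mat n n" "N \<in> carrier_mat n n"
    and e: "e * e = e" "x * e = e * x" "e * (x * x) = 0\<^sub>m n n"
    and N: "(e * x) * N * (e * x) = e * x"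
  shows "\<exists>s p. homology_data n e x s p \<and> mat_trace p = mat_trace e - 2 * mat_trace ((e * x) * N)"
proof -
  note mm = assoc_mult_mat[of _ n n _ n _ n] add_mult_distrib_mat[of _ n n _ _ n]
    mult_add_distrib_mat[of _ n n _ n] minus_mult_distrib_mat[of _ n n _ _ n]
    mult_minus_distrib_mat[of _ n n _ n]
  define y where "y = e * x"
  define s where "s = e * N * e"
  define p where "p = e - (x * s + s * x)"
  have y: "y \<in> carrier_mat n n" using c by (simp add: y_def)
  have s: "s \<in> carrier_mat n n" using c by (simp add: s_def)
  have p: "p \<in> carrier_mat n n"
    unfolding p_def using c s by (intro minus_carrier_mat add_carrier_mat mult_carrier_mat[of _ n n]) auto
  have ee: "e * (e * A) = e * A" "x * (e * A) = e * (x * A)" "e * (x * (x * A)) = 0\<^sub>m n n"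
    if "A \<in> carrier_mat n n" for A
  proof -
    show "e * (e * A) = e * A" using arg_cong[OF e(1), of "\<lambda>B. B * A"] c that by (simp add: mm)
    show "x * (e * A) = e * (x * A)" using arg_cong[OF e(2), of "\<lambda>B. B * A"] c that by (simp add: mm)
    show "e * (x * (x * A)) = 0\<^sub>m n n" using arg_cong[OF e(3), of "\<lambda>B. B * A"] c that by (simp add: mm)
  qed
  have sandwich: "e * (x * (N * (e * x))) = e * x" using N c by (simp add: mm)
  have es: "e * s = s" "s * e = s" using c by (simp_all add: s_def mm ee e)
  have es': "e * (x * s) = x * s" "e * (s * x) = s * x" "s * (e * x) = s * x"
    using ee(2)[OF s] assoc_mult_mat[OF c(1) s c(2)] assoc_mult_mat[OF s c(1,2)]
    by (simp_all add: es)
  have ep: "e * p = p" "p * e = p" using c s by (simp_all add: p_def mm e es es')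
  \<comment> \<open>The identity \<open>x * (s * x) = e * x\<close> is where the generalized inverse
    enters. With it, \<open>x * p\<close> and \<open>p * x\<close> cancel to zero.\<close>
  have xx: "x * (x * s) = 0\<^sub>m n n" "s * (x * x) = 0\<^sub>m n n" "x * (s * x) = e * x"
    using c by (simp_all add: s_def mm ee e sandwich)
  have xp: "x * p = 0\<^sub>m n n" "p * x = 0\<^sub>m n n"
    using c s by (simp_all add: p_def mm xx e)
  have sum: "p + (x * s + s * x) = e"
    unfolding p_def by (rule eq_matI) (use c s in auto)
  have data: "homology_data n e x s p"
    unfolding homology_data_def using s p es ep xp sum by simp
  have tr: "mat_trace (x * s) = mat_trace (y * N)" "mat_trace (s * x) = mat_trace (y * N)"
  proof -
    have "mat_trace (x * s) = mat_trace ((y * N) * e)" using c by (simp add: s_def y_def mm ee)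
    also have "\<dots> = mat_trace (e * (y * N))" using c y by (intro mat_trace_comm[of _ n n]) auto
    also have "e * (y * N) = y * N" using c by (simp add: y_def mm ee)
    finally show "mat_trace (x * s) = mat_trace (y * N)" .
    then show "mat_trace (s * x) = mat_trace (y * N)" using mat_trace_comm[OF s c(2)] by simp
  qed
  have "mat_trace e = mat_trace p + (mat_trace (x * s) + mat_trace (s * x))"
    using c s p by (subst sum[symmetric]) (simp add: mat_trace_add[of _ n])
  then have "mat_trace p = mat_trace e - 2 * mat_trace ((e * x) * N)"
    by (simp add: tr y_def)
  with data show ?thesis by blast
qed

text \<open>The map sending \<open>A\<close> to \<open>P * A * Q\<close> is additive, and
  multiplicative because \<open>Q * P = 1\<close>, so every defining equation is
  transported.\<close>

lemma homology_data_conjugate: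
  fixes x :: "'a::comm_ring_1 mat"
  assumes c: "e \<in> carrier_mat m m" "x \<in> carrier_mat m m" "P \<in> carrier_mat n m" "Q \<in> carrier_mat m n"
    and QP: "Q * P = 1\<^sub>m m" and d: "homology_data m e x s p"
  shows "homology_data n (P * e * Q) (P * x * Q) (P * s * Q) (P * p * Q)"
    and "mat_trace (P * p * Q) = mat_trace p"
proof -
  have s: "s \<in> carrier_mat m m" and p: "p \<in> carrier_mat m m"
    using d by (auto simp: homology_data_def)
  define K where "K = (\<lambda>A. P * A * Q)"
  have K: "K A \<in> carrier_mat n n" "K (0\<^sub>m m m) = 0\<^sub>m n n" if "A \<in> carrier_mat m m" for A
    using that c by (auto simp: K_def)
  have mult: "K A * K B = K (A * B)"
    if "A \<in> carrier_mat m m" "B \<in> carrier_mat m m" for A B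
  proof -
    have "K A * K B = (P * A) * (B * Q)"
      using mat_cancel_middle[of "P * A" n m Q n P "B * Q" n] that c QP
      by (simp add: K_def assoc_mult_mat[of _ n m _ m _ n])
    then show ?thesis using that c
      by (simp add: K_def mult_carrier_mat[of _ m m _ n] mult_carrier_mat[of _ m m _ m]
          assoc_mult_mat[of _ n m _ m _ n] assoc_mult_mat[of _ m m _ m _ n])
  qed
  have add: "K A + K B = K (A + B)"
    if "A \<in> carrier_mat m m" "B \<in> carrier_mat m m" for A B
    using that c by (simp add: K_def mult_add_distrib_mat[of _ n m _ m] add_mult_distrib_mat[of _ n m _ _ n])
  have "homology_data n (K e) (K x) (K s) (K p)"
    using d c s p K[OF c(1)]
    by (simp add: homology_data_def mult add K mult_carrier_mat[of _ m m _ m])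
  then show "homology_data n (P * e * Q) (P * x * Q) (P * s * Q) (P * p * Q)"
    by (simp only: K_def)
  have "mat_trace (P * p * Q) = mat_trace (Q * (P * p))"
    using c p by (intro mat_trace_comm[of _ n m]) auto
  also have "Q * (P * p) = p" using c p QP assoc_mult_mat[of Q m n P m p m] by simp
  finally show "mat_trace (P * p * Q) = mat_trace p" .
qed

lemma homology_data_block_sum:
  fixes x :: "'a::comm_ring_1 mat"
  assumes c: "e \<in> carrier_mat m m" "x \<in> carrier_mat m m" "e' \<in> carrier_mat n n" "x' \<in> carrier_mat n n"
    and d: "homology_data m e x s p" "homology_data n e' x' s' p'"
  shows "homology_data (m + n) (block_sum e e') (block_sum x x') (block_sum s s') (block_sum p p')"
proof -
  have sp: "s \<in> carrier_mat m m" "p \<in> carrier_mat m m" "s' \<in> carrier_mat n n" "p' \<in> carrier_mat n n"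
    using d by (auto simp: homology_data_def)
  have z: "block_sum (0\<^sub>m m m) (0\<^sub>m n n) = (0\<^sub>m (m + n) (m + n) :: 'a mat)"
    by (intro eq_matI) (auto simp: block_sum_def)
  note bm = block_sum_mult[of _ m m _ n n _ m _ n] block_sum_add[of _ m m _ _ n n, symmetric]
  show ?thesis
    unfolding homology_data_def using c sp d[unfolded homology_data_def]
    by (simp add: bm z mult_carrier_mat[of _ m m _ m] mult_carrier_mat[of _ n n _ n])
qed

section \<open>The homology of a module at a point\<close>

abbreviation module_homology :: "'k::field \<Rightarrow> 'k d4_module \<Rightarrow> 'k mat \<Rightarrow> 'k mat \<Rightarrow> bool" where
  "module_homology \<eta> M \<equiv> homology_data (mdim M) (act M d4_even) (act M (d4_lin \<eta>))"

text \<open>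
  The dimension of the homology of \<open>d4_lin \<eta>\<close> on the block \<open>b c = 1\<close>, as an element of \<open>k\<close>. Working in \<open>k\<close>
  instead of \<open>\<nat>\<close> lets traces replace ranks. The description is proper when \<open>2 \<noteq> 0\<close>.
\<close>
definition homology_trace :: "'k::field \<Rightarrow> 'k d4_module \<Rightarrow> 'k" where
  "homology_trace \<eta> M = (THE t. \<exists>s p. module_homology \<eta> M s p \<and> t = mat_trace p)"

lemma homology_trace_eqI:
  assumes "module_homology \<eta> M s p"
  shows "homology_trace \<eta> M = mat_trace p"
  unfolding homology_trace_def
  using assms homology_data_trace_unique[OF act_carrier] by (intro the_equality) blast+

text \<open>The factor \<open>q\<close> is kept so that the lemma applies directly to
  \<open>generalized_inverse_domain\<close> over \<open>k\<close>, and to a generalized inverse over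
  \<open>k[t]\<close> after evaluation at a point.\<close>

lemma homology_trace_generalized_inverse:
  fixes M :: "'k::field d4_module"
  assumes two: "(2 :: 'k) \<noteq> 0" and N: "N \<in> carrier_mat (mdim M) (mdim M)" and q: "q \<noteq> 0"
    and YNY: "act M (d4_even * d4_lin \<eta>) * N * act M (d4_even * d4_lin \<eta>) = q \<cdot>\<^sub>m act M (d4_even * d4_lin \<eta>)"
    and tr: "mat_trace (act M (d4_even * d4_lin \<eta>) * N) = r * q"
  shows "\<exists>s p. module_homology \<eta> M s p"
    and "homology_trace \<eta> M = mat_trace (act M d4_even) - 2 * r"
proof -
  let ?n = "mdim M" and ?Y = "act M d4_even * act M (d4_lin \<eta>)"
  define N' where "N' = inverse q \<cdot>\<^sub>m N"
  have N': "N' \<in> carrier_mat ?n ?n" using N by (simp add: N'_def)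
  have YN': "?Y * N' = inverse q \<cdot>\<^sub>m (?Y * N)"
    unfolding N'_def by (rule mult_smult_distrib[of _ ?n ?n _ ?n]) (use N in \<open>auto intro: mult_carrier_mat[of _ ?n ?n]\<close>)
  have "?Y * N' * ?Y = inverse q \<cdot>\<^sub>m (?Y * N * ?Y)"
    unfolding YN' by (rule mult_smult_assoc_mat[of _ ?n ?n _ ?n]) (use N in \<open>auto intro!: mult_carrier_mat[of _ ?n ?n]\<close>)
  also have "\<dots> = inverse q \<cdot>\<^sub>m (q \<cdot>\<^sub>m ?Y)"
    using YNY by (simp only: act_mult)
  also have "\<dots> = ?Y" using q by (intro eq_matI) auto
  finally have inv: "?Y * N' * ?Y = ?Y" .
  have r: "mat_trace (?Y * N') = r"
    using tr q N unfolding YN' by (subst mat_trace_smult[of _ ?n]) (auto simp: act_mult intro!: mult_carrier_mat[of _ ?n ?n])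
  have "d4_lin \<eta> * d4_even = d4_even * d4_lin \<eta>" by (rule d4_even_central[symmetric])
  then obtain s p where sp: "module_homology \<eta> M s p" "mat_trace p = mat_trace (act M d4_even) - 2 * mat_trace (?Y * N')"
    using homology_data_exists[OF act_carrier act_carrier N' _ _ _ inv]
    by (metis act_mult act_0 d4_even_odd(1)[OF two] d4_lin_square)
  then show "\<exists>s p. module_homology \<eta> M s p" by blast
  show "homology_trace \<eta> M = mat_trace (act M d4_even) - 2 * r"
    using sp r homology_trace_eqI by metis
qed

lemma module_homology_exists:
  fixes M :: "'k::field d4_module"
  assumes "(2 :: 'k) \<noteq> 0"
  obtains s p where "module_homology \<eta> M s p"
  using generalized_inverse_domain[OF act_carrier[of M "d4_even * d4_lin \<eta>"]]
    homology_trace_generalized_inverse(1)[OF assms] by blast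

section \<open>Dependence of the homology on the point\<close>

lemma map_mat_poly_mult:
  fixes A :: "'a::comm_ring_1 poly mat"
  assumes "A \<in> carrier_mat m n" "B \<in> carrier_mat n l"
  shows "map_mat (\<lambda>p. poly p x) (A * B) = map_mat (\<lambda>p. poly p x) A * map_mat (\<lambda>p. poly p x) B"
  using assms by (intro eq_matI) (auto simp: scalar_prod_def poly_sum)

lemma mat_trace_map_poly:
  fixes A :: "'a::comm_ring_1 poly mat"
  assumes "A \<in> carrier_mat n n"
  shows "mat_trace (map_mat (\<lambda>p. poly p x) A) = poly (mat_trace A) x"
  using assms by (auto simp: mat_trace_def poly_sum)

text \<open>The matrices of \<open>d4_even * d4_lin \<eta>\<close> are the values of one matrix
  \<open>Y\<close> with entries linear in \<open>t\<close>. A generalized inverse of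
  \<open>Y\<close> over \<open>k[t]\<close> specializes at every \<open>\<eta>\<close> that is not a
  root of \<open>q\<close>, always with the same \<open>r\<close>; the exceptional points are
  therefore among the roots of \<open>q\<close>.\<close>

lemma homology_trace_generically_constant:
  fixes M :: "'k::field d4_module"
  assumes two: "(2 :: 'k) \<noteq> 0"
  shows "\<exists>v. finite {\<eta>. homology_trace \<eta> M \<noteq> v}"
proof -
  let ?n = "mdim M" and ?ev = "\<lambda>\<eta>. map_mat (\<lambda>p. poly p \<eta>) :: 'k poly mat \<Rightarrow> 'k mat"
  define Y where "Y = mat ?n ?n (\<lambda>ij. [: act M (d4_even * d4_a) $$ ij, act M (d4_even * d4_d) $$ ij :])"
  have Y: "Y \<in> carrier_mat ?n ?n" by (simp add: Y_def)
  have evY: "?ev \<eta> Y = act M (d4_even * d4_lin \<eta>)" for \<eta>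
  proof -
    have "d4_even * d4_lin \<eta> = d4_even * d4_a + d4_scal \<eta> * (d4_even * d4_d)"
      by (simp add: d4_lin_def semiring_class.distrib_left d4_scal_left)
    moreover have "act M (d4_scal \<eta> * x) = \<eta> \<cdot>\<^sub>m act M x" for x
      by (simp add: act_mult act_scal mult_smult_assoc_mat[of _ ?n ?n _ ?n])
    ultimately show ?thesis by (intro eq_matI) (auto simp: Y_def act_add)
  qed
  obtain N q r where N: "N \<in> carrier_mat ?n ?n" and q: "q \<noteq> 0"
    and YNY: "Y * N * Y = q \<cdot>\<^sub>m Y" and tr: "mat_trace (Y * N) = of_nat r * q"
    using generalized_inverse_domain[OF Y] by blast
  have "homology_trace \<eta> M = mat_trace (act M d4_even) - 2 * of_nat r" if "poly q \<eta> \<noteq> 0" for \<eta>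
  proof (rule homology_trace_generalized_inverse(2)[OF two _ that])
    show "?ev \<eta> N \<in> carrier_mat ?n ?n" using N by simp
    have "?ev \<eta> (Y * N * Y) = ?ev \<eta> Y * ?ev \<eta> N * ?ev \<eta> Y"
      by (simp only: map_mat_poly_mult[OF mult_carrier_mat[OF Y N] Y] map_mat_poly_mult[OF Y N])
    moreover have "?ev \<eta> (q \<cdot>\<^sub>m Y) = poly q \<eta> \<cdot>\<^sub>m ?ev \<eta> Y"
      by (intro eq_matI) auto
    ultimately show "act M (d4_even * d4_lin \<eta>) * ?ev \<eta> N * act M (d4_even * d4_lin \<eta>) =
        poly q \<eta> \<cdot>\<^sub>m act M (d4_even * d4_lin \<eta>)"
      unfolding YNY evY by metis
    have "mat_trace (?ev \<eta> (Y * N)) = of_nat r * poly q \<eta>"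
      using mat_trace_map_poly[OF mult_carrier_mat[OF Y N]] tr by simp
    then show "mat_trace (act M (d4_even * d4_lin \<eta>) * ?ev \<eta> N) = of_nat r * poly q \<eta>"
      unfolding map_mat_poly_mult[OF Y N] evY .
  qed
  then have "{\<eta>. homology_trace \<eta> M \<noteq> mat_trace (act M d4_even) - 2 * of_nat r} \<subseteq> {\<eta>. poly q \<eta> = 0}"
    by blast
  then show ?thesis using poly_roots_finite[OF q] finite_subset by blast
qed

section \<open>Isomorphism invariance, direct sums and the unit\<close>

lemma homology_trace_iso:
  fixes M :: "'k::field d4_module"
  assumes two: "(2 :: 'k) \<noteq> 0" and iso: "d4_iso M N"
  shows "homology_trace \<eta> M = homology_trace \<eta> N"
proof -
  obtain s p where sp: "module_homology \<eta> M s p" using module_homology_exists[OF two] .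
  obtain P Q where P: "d4_hom M N P" and Q: "d4_hom N M Q"
    and PQ: "P * Q = 1\<^sub>m (mdim N)" "Q * P = 1\<^sub>m (mdim M)"
    using iso by (auto simp: d4_iso_def)
  note c = P[THEN d4_hom_carrier] Q[THEN d4_hom_carrier]
  have act: "P * act M x * Q = act N x" for x
  proof -
    have "P * act M x * Q = act N x * P * Q" using P by (simp add: d4_hom_def)
    also have "\<dots> = act N x * (P * Q)" by (rule assoc_mult_mat[OF act_carrier c])
    also have "\<dots> = act N x" unfolding PQ by (rule right_mult_one_mat[OF act_carrier])
    finally show ?thesis .
  qed
  note conj = homology_data_conjugate[OF act_carrier act_carrier c PQ(2) sp]
  show ?thesis
    using homology_trace_eqI[OF conj(1)[unfolded act]] conj(2) homology_trace_eqI[OF sp] by simp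
qed

lemma homology_trace_sum:
  fixes M :: "'k::field d4_module"
  assumes two: "(2 :: 'k) \<noteq> 0"
  shows "homology_trace \<eta> (module_sum M N) = homology_trace \<eta> M + homology_trace \<eta> N"
proof -
  obtain s p where M: "module_homology \<eta> M s p" using module_homology_exists[OF two] .
  obtain s' p' where N: "module_homology \<eta> N s' p'" using module_homology_exists[OF two] .
  have sum: "module_homology \<eta> (module_sum M N) (block_sum s s') (block_sum p p')"
    using homology_data_block_sum[OF act_carrier act_carrier act_carrier act_carrier M N]
    by (simp add: act_sum)
  have "p \<in> carrier_mat (mdim M) (mdim M)" "p' \<in> carrier_mat (mdim N) (mdim N)"
    using M N by (auto simp: homology_data_def)
  then show ?thesis
    unfolding homology_trace_eqI[OF M] homology_trace_eqI[OF N] homology_trace_eqI[OF sum]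
    by (rule mat_trace_block_sum)
qed

lemma homology_trace_unit:
  assumes two: "(2 :: 'k::field) \<noteq> 0"
  shows "homology_trace \<eta> (module_unit :: 'k d4_module) = 1"
proof -
  have "d4_counit (1 :: 'k d4) = 1" using d4_counit_simps(5)[of 1] by (simp add: d4_scal_1)
  then have "act module_unit d4_even = (1\<^sub>m 1 :: 'k mat)"
    using two by (auto simp: act_unit d4_even_def intro!: eq_matI)
  moreover have "act module_unit (d4_lin \<eta>) = 0\<^sub>m 1 1"
    by (auto simp: act_unit d4_lin_def intro!: eq_matI)
  ultimately have "module_homology \<eta> module_unit (0\<^sub>m 1 1) (1\<^sub>m 1)"
    by (simp add: homology_data_def)
  then show ?thesis by (simp add: homology_trace_eqI mat_trace_def)
qed

section \<open>Tensor products\<close>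

lemma act_scal_mult: "act M (d4_scal r * x) = r \<cdot>\<^sub>m act M x"
  by (simp add: act_mult act_scal mult_smult_assoc_mat[of _ "mdim M" "mdim M" _ "mdim M"])

lemma act_tensor_simps:
  "act (module_tensor M N) d4_a = kron (act M d4_a) (act N d4_b) + kron (act M 1) (act N d4_a)"
  "act (module_tensor M N) d4_b = kron (act M d4_b) (act N d4_b)"
  "act (module_tensor M N) d4_c = kron (act M d4_c) (act N d4_c)"
  "act (module_tensor M N) d4_d = kron (act M d4_d) (act N d4_c) + kron (act M 1) (act N d4_d)"
  by (simp_all only: act_tensor tensor_act_simps)

text \<open>The terms for \<open>a\<close> and \<open>d\<close> stay separate because their second
  factors are \<open>b\<close> and \<open>c\<close>; they merge only where \<open>b\<close> and
  \<open>c\<close> act alike.\<close>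

lemma act_tensor_lin:
  "act (module_tensor M N) (d4_lin \<eta>) = kron (act M d4_a) (act N d4_b) +
     (kron (act M (d4_scal \<eta> * d4_d)) (act N d4_c) + kron (act M 1) (act N (d4_lin \<eta>)))"
  by (rule eq_matI)
    (auto simp: d4_lin_def act_add act_scal_mult act_tensor_simps algebra_simps
      index_kron[of _ "mdim M" "mdim M" _ "mdim N" "mdim N"] mod_less_of_less_mult
      div_less_of_less_mult)

text \<open>\<open>b c\<close> is group-like, so it acts as \<open>1\<close> on a tensor product of
  eigenvectors with eigenvalues \<open>1\<close> or \<open>-1\<close> exactly when the two
  eigenvalues agree.\<close>

lemma act_tensor_even:
  fixes M N :: "'k::field d4_module"
  assumes two: "(2 :: 'k) \<noteq> 0"
  shows "act (module_tensor M N) d4_even =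
    kron (act M d4_even) (act N d4_even) + kron (act M d4_odd) (act N d4_odd)"
proof -
  let ?m = "mdim M" and ?n = "mdim N"
  have bc: "act (module_tensor M N) (d4_b * d4_c) = kron (act M (d4_b * d4_c)) (act N (d4_b * d4_c))"
    by (simp add: act_mult act_tensor_simps kron_mult[of _ ?m ?m _ ?n ?n _ ?m _ ?n])
  have one: "act (module_tensor M N) 1 = kron (act M 1) (act N 1)"
    by (simp add: act_1)
  have odd: "d4_odd = d4_scal (1 / 2) * (1 + - (d4_b * d4_c) :: 'k d4)"
    by (simp add: d4_odd_def)
  \<comment> \<open>The claim read off entry by entry: \<open>t\<close>, \<open>t'\<close> stand for
    entries of the identities, \<open>u\<close>, \<open>u'\<close> for entries of
    \<open>b c\<close>, and \<open>h\<close> for one half.\<close>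
  have "h * (t * t' + u * u') = h * (t + u) * (h * (t' + u')) + h * (t + - 1 * u) * (h * (t' + - 1 * u'))"
    if "h + h = 1" for h t t' u u' :: 'k
  proof -
    have "h * (t + u) * (h * (t' + u')) + h * (t + - 1 * u) * (h * (t' + - 1 * u')) =
      (h + h) * (h * (t * t' + u * u'))"
      by (simp add: algebra_simps)
    then show ?thesis by (simp add: that)
  qed
  moreover have "1 / 2 + 1 / 2 = (1 :: 'k)" using two by (simp add: field_simps)
  ultimately have arith: "1 / 2 * (t * t' + u * u') =
      1 / 2 * (t + u) * (1 / 2 * (t' + u')) + 1 / 2 * (t + - 1 * u) * (1 / 2 * (t' + - 1 * u'))"
    for t t' u u' :: 'k by blast
  show ?thesis
  proof (rule eq_matI)
    fix i j
    assume "i < dim_row (kron (act M d4_even) (act N d4_even) + kron (act M d4_odd) (act N d4_odd))"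
      "j < dim_col (kron (act M d4_even) (act N d4_even) + kron (act M d4_odd) (act N d4_odd))"
    then have ij: "i < ?m * ?n" "j < ?m * ?n" by auto
    note ij' = ij[THEN div_less_of_less_mult] ij[THEN mod_less_of_less_mult]
    show "act (module_tensor M N) d4_even $$ (i, j) =
        (kron (act M d4_even) (act N d4_even) + kron (act M d4_odd) (act N d4_odd)) $$ (i, j)"
      using ij ij' arith
      unfolding odd d4_even_def act_scal_mult act_add act_uminus bc one
      by (simp add: index_kron[of _ ?m ?m _ ?n ?n] del: index_mult_mat(1))
  qed auto
qed

text \<open>\<open>b\<close> times the even idempotent is the grading operator of the even block: an
  involution there, anticommuting with \<open>d4_lin \<eta>\<close>. It supplies the Koszul sign in
  the tensor product homotopy.\<close>

lemma d4_b_even: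
  "d4_b * (d4_b * d4_even) = d4_even" "d4_c * (d4_b * d4_even) = d4_even"
  "d4_b * d4_even * d4_b = d4_even" "d4_b * d4_even * d4_c = d4_even"
  "d4_lin \<eta> * (d4_b * d4_even) + d4_b * d4_even * d4_lin \<eta> = 0"
  by (simp_all add: d4_even_def d4_lin_def d4_norm)

text \<open>These anticommutators cancel the twisted terms of the comultiplication when
  \<open>d / 2\<close> acts on the second factor as a homotopy.\<close>

lemma d4_odd_d:
  "d4_b * (d4_odd * d4_d) + d4_odd * d4_d * d4_b = 0"
  "d4_c * (d4_odd * d4_d) + d4_odd * d4_d * d4_c = 0"
  by (simp_all add: d4_odd_def d4_norm)

text \<open>The Kuenneth formula in explicit form: an explicit homotopy shows that
  \<open>kron p p'\<close> projects onto the homology of the tensor product, and the trace is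
  multiplicative on Kronecker products.\<close>

lemma homology_trace_tensor:
  fixes M N :: "'k::field d4_module"
  assumes two: "(2 :: 'k) \<noteq> 0"
  shows "homology_trace \<eta> (module_tensor M N) = homology_trace \<eta> M * homology_trace \<eta> N"
proof -
  let ?m = "mdim M" and ?n = "mdim N"
  let ?C = "carrier_mat ?m ?m" and ?D = "carrier_mat ?n ?n"
  let ?X = "act (module_tensor M N) (d4_lin \<eta>)" and ?E = "act (module_tensor M N) d4_even"
  let ?e = "act M d4_even" and ?f = "act M d4_odd" and ?x = "act M (d4_lin \<eta>)"
  let ?xa = "act M d4_a" and ?xd = "act M (d4_scal \<eta> * d4_d)"
  let ?e' = "act N d4_even" and ?f' = "act N d4_odd" and ?y = "act N (d4_lin \<eta>)"
  let ?b = "act N d4_b" and ?c = "act N d4_c"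
  obtain s p where M: "module_homology \<eta> M s p" using module_homology_exists[OF two] .
  obtain s' p' where N: "module_homology \<eta> N s' p'" using module_homology_exists[OF two] .
  have c: "s \<in> ?C" "p \<in> ?C" "s' \<in> ?D" "p' \<in> ?D" using M N by (auto simp: homology_data_def)
  have Me: "?e * s = s" "s * ?e = s" "?e * p = p" "p * ?e = p"
    and Mx: "?x * p = 0\<^sub>m ?m ?m" "p * ?x = 0\<^sub>m ?m ?m" and Ms: "p + (?x * s + s * ?x) = ?e"
    using M by (auto simp: homology_data_def)
  have Ne: "?e' * s' = s'" "s' * ?e' = s'" "?e' * p' = p'" "p' * ?e' = p'"
    and Nx: "?y * p' = 0\<^sub>m ?n ?n" "p' * ?y = 0\<^sub>m ?n ?n" and Ns: "p' + (?y * s' + s' * ?y) = ?e'"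
    using N by (auto simp: homology_data_def)
  have mc: "A * B \<in> carrier_mat k k" if "A \<in> carrier_mat k k" "B \<in> carrier_mat k k" for A B :: "'k mat" and k
    using that by simp
  have x: "?x = ?xa + ?xd" by (simp add: d4_lin_def act_add)

  have f0: "?f * P = 0\<^sub>m ?m ?m" if "P \<in> ?C" "?e * P = P" for P
  proof -
    have "?f * P = ?f * (?e * P)" using that by simp
    also have "\<dots> = act M (d4_odd * d4_even) * P"
      unfolding act_mult by (rule assoc_mult_mat[symmetric, OF act_carrier act_carrier that(1)])
    also have "\<dots> = 0\<^sub>m ?m ?m"
      unfolding d4_even_odd(4)[OF two] act_0 by (rule left_mult_zero_mat[OF that(1)])
    finally show ?thesis .
  qed
  have f0': "P * ?f = 0\<^sub>m ?m ?m" if "P \<in> ?C" "P * ?e = P" for P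
  proof -
    have "P * ?f = (P * ?e) * ?f" using that by simp
    also have "\<dots> = P * act M (d4_even * d4_odd)"
      unfolding act_mult by (rule assoc_mult_mat[OF that(1) act_carrier act_carrier])
    also have "\<dots> = 0\<^sub>m ?m ?m"
      unfolding d4_even_odd(3)[OF two] act_0 by (rule right_mult_zero_mat[OF that(1)])
    finally show ?thesis .
  qed
  \<comment> \<open>A matrix supported on the even block of \<open>N\<close> does not distinguish
    \<open>b\<close> from \<open>c\<close>.\<close>
  have cb: "?c * Q = ?b * Q" if "Q \<in> ?D" "?e' * Q = Q" for Q
  proof -
    have "act N u * Q = act N (u * d4_even) * Q" for u
      unfolding act_mult using that(2) assoc_mult_mat[OF act_carrier act_carrier that(1)] by metis
    then show ?thesis using d4_even_c by metis
  qed
  have cb': "Q * ?c = Q * ?b" if "Q \<in> ?D" "Q * ?e' = Q" for Q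
  proof -
    have "Q * act N u = Q * act N (u * d4_even)" for u
      unfolding d4_even_central[of u, symmetric] act_mult
      using that(2) assoc_mult_mat[OF that(1) act_carrier act_carrier] by metis
    then show ?thesis using d4_even_c by metis
  qed

  have km: "kron P Q * kron P' Q' = kron (P * P') (Q * Q')"
    if "P \<in> ?C" "P' \<in> ?C" "Q \<in> ?D" "Q' \<in> ?D" for P P' Q Q' :: "'k mat"
    by (rule kron_mult[OF that(1,3,2,4)])
  have kc: "kron P Q \<in> carrier_mat (?m * ?n) (?m * ?n)" if "P \<in> ?C" "Q \<in> ?D" for P Q :: "'k mat"
    using that by simp
  have ka: "kron P Q + kron P' Q = kron (P + P') Q" if "P \<in> ?C" "P' \<in> ?C" "Q \<in> ?D" for P P' Q :: "'k mat"
    by (rule kron_add_left[symmetric, OF that])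
  have ka': "kron P Q + kron P Q' = kron P (Q + Q')" if "P \<in> ?C" "Q \<in> ?D" "Q' \<in> ?D" for P Q Q' :: "'k mat"
    by (rule kron_add_right[symmetric, OF that])
  have XK: "?X * kron P Q = kron (?xa * P) (?b * Q) + (kron (?xd * P) (?c * Q) + kron P (?y * Q))"
    if "P \<in> ?C" "Q \<in> ?D" for P Q
    using that
    by (simp add: act_tensor_lin km kc act_1 add_mult_distrib_mat[of _ "?m * ?n" "?m * ?n" _ _ "?m * ?n"])
  have KX: "kron P Q * ?X = kron (P * ?xa) (Q * ?b) + (kron (P * ?xd) (Q * ?c) + kron P (Q * ?y))"
    if "P \<in> ?C" "Q \<in> ?D" for P Q
    using that
    by (simp add: act_tensor_lin km kc act_1 mult_add_distrib_mat[of _ "?m * ?n" "?m * ?n" _ "?m * ?n"])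
  \<comment> \<open>Once \<open>c\<close> acts as \<open>b\<close>, the terms for \<open>a\<close>
    and \<open>d\<close> combine into one term with \<open>?x\<close>, as in the differential of a
    tensor product of complexes.\<close>
  have XK': "?X * kron P Q = kron (?x * P) (?b * Q) + kron P (?y * Q)"
    if "P \<in> ?C" "Q \<in> ?D" "?c * Q = ?b * Q" for P Q
    unfolding XK[OF that(1,2)] that(3) x using that
    by (simp add: mc kc ka[symmetric] add_mult_distrib_mat[of _ ?m ?m _ _ ?m] assoc_add_mat[of _ "?m * ?n" "?m * ?n"])
  have KX': "kron P Q * ?X = kron (P * ?x) (Q * ?b) + kron P (Q * ?y)"
    if "P \<in> ?C" "Q \<in> ?D" "Q * ?c = Q * ?b" for P Q
    unfolding KX[OF that(1,2)] that(3) x using that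
    by (simp add: mc kc ka[symmetric] mult_add_distrib_mat[of _ ?m ?m _ ?m] assoc_add_mat[of _ "?m * ?n" "?m * ?n"])
  have EK: "?E * kron P Q = kron (?e * P) (?e' * Q) + kron (?f * P) (?f' * Q)"
    and KE: "kron P Q * ?E = kron (P * ?e) (Q * ?e') + kron (P * ?f) (Q * ?f')"
    if "P \<in> ?C" "Q \<in> ?D" for P Q
    using that unfolding act_tensor_even[OF two]
    by (simp_all add: km kc add_mult_distrib_mat[of _ "?m * ?n" "?m * ?n" _ _ "?m * ?n"]
        mult_add_distrib_mat[of _ "?m * ?n" "?m * ?n" _ "?m * ?n"])

  let ?S = "carrier_mat (?m * ?n) (?m * ?n)"
  have swap: "(A + B) + (A' + B') = (A + A') + (B + B')"
    if "A \<in> ?S" "B \<in> ?S" "A' \<in> ?S" "B' \<in> ?S"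
    for A B A' B' :: "'k mat"
    using that by (intro eq_matI) auto
  have swap3: "(A + (B + C)) + (A' + (B' + C')) = (A + A') + ((B + B') + (C + C'))"
    if "A \<in> ?S" "B \<in> ?S" "C \<in> ?S"
      "A' \<in> ?S" "B' \<in> ?S" "C' \<in> ?S"
    for A B C A' B' C' :: "'k mat"
    using that by (intro eq_matI) auto
  have shuffle: "P + ((A + (B + C)) + (A' + (B' + C'))) = ((P + (B + B')) + (A + A')) + (C + C')"
    if "P \<in> ?S" "A \<in> ?S" "B \<in> ?S" "C \<in> ?S"
      "A' \<in> ?S" "B' \<in> ?S" "C' \<in> ?S"
    for P A B C A' B' C' :: "'k mat"
    using that by (intro eq_matI) (auto simp: algebra_simps)

  \<comment> \<open>\<open>V\<close> undoes the twist, since \<open>?b * V\<close> and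
    \<open>V * ?b\<close> are the even idempotent, and it anticommutes with \<open>?y\<close>.
    \<open>W\<close> is the contracting homotopy on the odd block.\<close>
  define V where "V = act N (d4_b * d4_even)"
  define W where "W = act N (d4_scal (1 / 2) * (d4_odd * d4_d))"
  have V: "V \<in> ?D" and W: "W \<in> ?D" by (simp_all add: V_def W_def)
  have Vb: "?b * V = ?e'" "?c * V = ?e'" "V * ?b = ?e'" "V * ?c = ?e'" "?y * V + V * ?y = 0\<^sub>m ?n ?n"
    by (simp_all only: V_def act_mult[symmetric] act_add[symmetric] d4_b_even act_0)
  have Ve: "?e' * V = V" "V * ?e' = V"
    unfolding V_def act_mult[symmetric]
    by (metis d4_even_central d4_even_odd(1)[OF two] mult.assoc, metis d4_even_odd(1)[OF two] mult.assoc)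
  have half: "d4_scal (1 / 2) * z + d4_scal (1 / 2) * z' = d4_scal (1 / 2) * (z + z')" for z z' :: "'k d4"
    by (simp add: semiring_class.distrib_left)
  have Wb: "?b * W + W * ?b = 0\<^sub>m ?n ?n" "?c * W + W * ?c = 0\<^sub>m ?n ?n" "?y * W + W * ?y = ?f'"
    by (simp_all only: W_def act_mult[symmetric] act_add[symmetric] d4_scal_left mult.assoc half
        d4_odd_d[unfolded mult.assoc] d4_odd_homotopy[OF two, unfolded mult.assoc] mult_zero_right act_0)
  have Wf: "?f' * W = W" "W * ?f' = W"
    unfolding W_def act_mult[symmetric]
    by (metis d4_odd_central d4_even_odd(2)[OF two] mult.assoc d4_scal_left)+

  \<comment> \<open>The usual homotopy of a tensor product of complexes on even \<open>\<otimes>\<close> even; on odd \<open>\<otimes>\<close> odd the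
    homotopy \<open>d / 2\<close> of the second factor contracts everything.\<close>
  define S1 where "S1 = kron s V"
  define S2 where "S2 = kron p s'"
  define S3 where "S3 = kron ?f W"
  define S where "S = S1 + (S2 + S3)"
  have SC: "S1 \<in> ?S" "S2 \<in> ?S" "S3 \<in> ?S" using c V W by (simp_all add: S1_def S2_def S3_def)
  have XE: "?X \<in> ?S" "?E \<in> ?S" using act_carrier[of "module_tensor M N"] by simp_all
  have fC: "?f \<in> ?C" "?f' \<in> ?D" "?e \<in> ?C" "?e' \<in> ?D" "?x \<in> ?C" "?y \<in> ?D" by simp_all
  \<comment> \<open>The terms with \<open>?y\<close> cancel because \<open>V\<close> anticommutes
    with \<open>?y\<close>.\<close>
  have T1: "?X * S1 + S1 * ?X = kron (?x * s + s * ?x) ?e'"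
  proof -
    have "?X * S1 + S1 * ?X = (kron (?x * s) ?e' + kron s (?y * V)) + (kron (s * ?x) ?e' + kron s (V * ?y))"
      using XK'[OF c(1) V] KX'[OF c(1) V] by (simp add: S1_def Vb)
    also have "\<dots> = (kron (?x * s) ?e' + kron (s * ?x) ?e') + (kron s (?y * V) + kron s (V * ?y))"
      by (rule swap) (use c V fC in \<open>simp_all add: mc kc\<close>)
    also have "\<dots> = kron (?x * s + s * ?x) ?e' + kron s (?y * V + V * ?y)"
      using c V fC by (simp only: ka ka' mc)
    also have "\<dots> = kron (?x * s + s * ?x) ?e'"
      using c V fC kc[of "?x * s + s * ?x" ?e'] by (simp add: Vb mc)
    finally show ?thesis .
  qed
  \<comment> \<open>The terms with \<open>?x\<close> vanish because \<open>?x * p\<close> and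
    \<open>p * ?x\<close> are zero.\<close>
  have T2: "?X * S2 + S2 * ?X = kron p (?y * s' + s' * ?y)"
  proof -
    have z: "kron (0\<^sub>m ?m ?m) Q + kron P Q' = kron P Q'" if "P \<in> ?C" "Q \<in> ?D" "Q' \<in> ?D" for P Q Q' :: "'k mat"
      using that kc[OF that(1,3)] by simp
    have "?X * S2 = kron p (?y * s')" "S2 * ?X = kron p (s' * ?y)"
      using XK'[OF c(2,3) cb[OF c(3) Ne(1)]] KX'[OF c(2,3) cb'[OF c(3) Ne(2)]] c fC
      by (simp_all only: S2_def Mx z mc act_carrier)
    then show ?thesis using ka'[OF c(2)] c fC by (simp only: mc)
  qed
  \<comment> \<open>Centrality of the odd idempotent gives the terms on either side the same first
    factor, so that the anticommutators of \<open>W\<close> with \<open>?b\<close> and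
    \<open>?c\<close> appear and vanish.\<close>
  have T3: "?X * S3 + S3 * ?X = kron ?f ?f'"
  proof -
    have com: "act M u * ?f = ?f * act M u" for u
      unfolding act_mult[symmetric] d4_odd_central ..
    have "?X * S3 + S3 * ?X =
      (kron (?xa * ?f) (?b * W) + (kron (?xd * ?f) (?c * W) + kron ?f (?y * W))) +
      (kron (?xa * ?f) (W * ?b) + (kron (?xd * ?f) (W * ?c) + kron ?f (W * ?y)))"
      unfolding S3_def XK[OF fC(1) W] KX[OF fC(1) W] com ..
    also have "\<dots> = (kron (?xa * ?f) (?b * W) + kron (?xa * ?f) (W * ?b)) +
      ((kron (?xd * ?f) (?c * W) + kron (?xd * ?f) (W * ?c)) + (kron ?f (?y * W) + kron ?f (W * ?y)))"
      by (rule swap3) (use W fC in \<open>simp_all add: mc kc\<close>)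
    also have "\<dots> = kron (?xa * ?f) (?b * W + W * ?b) +
      (kron (?xd * ?f) (?c * W + W * ?c) + kron ?f (?y * W + W * ?y))"
      using W by (simp only: ka' mc act_carrier)
    also have "\<dots> = kron ?f ?f'"
      using kc[OF fC(1,2)] by (simp add: Wb)
    finally show ?thesis .
  qed
  have XS: "?X * S = ?X * S1 + (?X * S2 + ?X * S3)" "S * ?X = S1 * ?X + (S2 * ?X + S3 * ?X)"
    unfolding S_def using SC XE
    by (simp_all add: mult_add_distrib_mat[of _ "?m * ?n" "?m * ?n" _ "?m * ?n"]
        add_mult_distrib_mat[of _ "?m * ?n" "?m * ?n" _ _ "?m * ?n"])
  \<comment> \<open>The contributions are collected in turn: adding that of \<open>S2\<close> to
    \<open>kron p p'\<close> gives \<open>kron p ?e'\<close>, adding that of \<open>S1\<close> gives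
    \<open>kron ?e ?e'\<close>, and adding that of \<open>S3\<close> gives
    \<open>?E\<close>.\<close>
  have "kron p p' + (?X * S + S * ?X) =
    ((kron p p' + (?X * S2 + S2 * ?X)) + (?X * S1 + S1 * ?X)) + (?X * S3 + S3 * ?X)"
    unfolding XS by (rule shuffle[OF kc[OF c(2,4)]]) (use SC XE in \<open>simp_all only: mc\<close>)
  also have "\<dots> = ?E"
  proof -
    have "kron p p' + kron p (?y * s' + s' * ?y) = kron p ?e'"
      using c by (simp only: ka' mc act_carrier add_carrier_mat Ns)
    moreover have "kron p ?e' + kron (?x * s + s * ?x) ?e' = kron ?e ?e'"
      using c by (simp only: ka mc act_carrier add_carrier_mat Ms)
    ultimately show ?thesis unfolding T1 T2 T3 act_tensor_even[OF two] by simp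
  qed
  finally have sum: "kron p p' + (?X * S + S * ?X) = ?E" .
  have z: "kron P Q + kron (0\<^sub>m ?m ?m) Q' = kron P Q" "kron P Q + kron P' (0\<^sub>m ?n ?n) = kron P Q"
    if "P \<in> ?C" "Q \<in> ?D" "P' \<in> ?C" "Q' \<in> ?D" for P P' Q Q' :: "'k mat"
    using that kc[OF that(1,2)] by simp_all
  have z': "kron (0\<^sub>m ?m ?m) Q' + kron P Q = kron P Q"
    if "P \<in> ?C" "Q \<in> ?D" "Q' \<in> ?D" for P Q Q' :: "'k mat"
    using that kc[OF that(1,2)] by simp
  have supp: "?E * kron P Q = kron P Q" "kron P Q * ?E = kron P Q"
    if "P \<in> ?C" "Q \<in> ?D" "?e * P = P" "P * ?e = P" "?e' * Q = Q" "Q * ?e' = Q" for P Q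
    unfolding EK[OF that(1,2)] KE[OF that(1,2)] that(3-6) f0[OF that(1,3)] f0'[OF that(1,4)]
    by (rule z(1)[OF that(1,2,1)]; use that in \<open>simp add: mc\<close>)+
  have supp3: "?E * S3 = S3" "S3 * ?E = S3"
    unfolding S3_def EK[OF fC(1) W] KE[OF fC(1) W] Wf
    unfolding act_mult[symmetric] d4_even_odd[OF two] act_0
    by (rule z'[OF fC(1) W]; use W in \<open>simp add: mc\<close>)+
  have ES: "?E * S = S" "S * ?E = S"
    using SC XE supp[OF c(1) V Me(1,2) Ve] supp[OF c(2,3) Me(3,4) Ne(1,2)] supp3
    unfolding S_def S1_def[symmetric] S2_def[symmetric]
    by (simp_all add: mult_add_distrib_mat[of _ "?m * ?n" "?m * ?n" _ "?m * ?n"]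
        add_mult_distrib_mat[of _ "?m * ?n" "?m * ?n" _ _ "?m * ?n"])
  have "?X * kron p p' = 0\<^sub>m (?m * ?n) (?m * ?n)" "kron p p' * ?X = 0\<^sub>m (?m * ?n) (?m * ?n)"
    using XK'[OF c(2,4) cb[OF c(4) Ne(3)]] KX'[OF c(2,4) cb'[OF c(4) Ne(4)]] c
    by (simp_all add: Mx Nx)
  then have tensor: "module_homology \<eta> (module_tensor M N) S (kron p p')"
    using supp[OF c(2,4) Me(3,4) Ne(3,4)] ES sum SC kc[OF c(2,4)]
    by (simp add: homology_data_def S_def)
  show ?thesis
    unfolding homology_trace_eqI[OF tensor] homology_trace_eqI[OF M] homology_trace_eqI[OF N]
    by (rule mat_trace_kron[OF c(2,4)])
qed

section \<open>Modules concentrated at a point\<close>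

primrec eval_term :: "nat \<Rightarrow> 'k mat \<Rightarrow> 'k mat \<Rightarrow> 'k mat \<Rightarrow> 'k mat \<Rightarrow> 'k::field d4_term \<Rightarrow> 'k mat" where
  "eval_term n A B C D TA = A"
| "eval_term n A B C D TB = B"
| "eval_term n A B C D TC = C"
| "eval_term n A B C D TD = D"
| "eval_term n A B C D (TScal r) = r \<cdot>\<^sub>m 1\<^sub>m n"
| "eval_term n A B C D (TAdd x y) = eval_term n A B C D x + eval_term n A B C D y"
| "eval_term n A B C D (TMul x y) = eval_term n A B C D x * eval_term n A B C D y"

text \<open>The universal property of the presentation: evaluation of terms respects every rule of
  \<open>d4_eq\<close> and so descends to the quotient.\<close>

lemma d4_module_of_matrices:
  fixes A :: "'k::field mat"
  assumes c: "A \<in> carrier_mat n n" "B \<in> carrier_mat n n" "C \<in> carrier_mat n n" "D \<in> carrier_mat n n"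
    and rel: "B * A = (-1) \<cdot>\<^sub>m (A * B)" "D * B = (-1) \<cdot>\<^sub>m (B * D)"
      "C * A = (-1) \<cdot>\<^sub>m (A * C)" "D * C = (-1) \<cdot>\<^sub>m (C * D)" "B * C = C * B"
      "A * A = 0\<^sub>m n n" "B * B = 1\<^sub>m n" "C * C = 1\<^sub>m n" "D * D = 0\<^sub>m n n"
      "D * A + A * D = 1\<^sub>m n + (-1) \<cdot>\<^sub>m (B * C)"
  obtains M where "mdim M = n" "act M d4_a = A" "act M d4_b = B" "act M d4_c = C" "act M d4_d = D"
proof -
  let ?ev = "eval_term n A B C D"
  have ev: "?ev t \<in> carrier_mat n n" for t
    by (induction t) (use c in \<open>auto intro: mult_carrier_mat[of _ n n]\<close>)
  have one: "1 \<cdot>\<^sub>m 1\<^sub>m n = (1\<^sub>m n :: 'k mat)" "0 \<cdot>\<^sub>m 1\<^sub>m n = (0\<^sub>m n n :: 'k mat)"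
    by (simp_all only: one_smult_one zero_smult_one)
  have scal: "(r \<cdot>\<^sub>m 1\<^sub>m n) * Z = r \<cdot>\<^sub>m Z" "Z * (r \<cdot>\<^sub>m 1\<^sub>m n) = r \<cdot>\<^sub>m Z"
    if "Z \<in> carrier_mat n n" for r and Z :: "'k mat"
    using that by (simp_all add: mult_smult_assoc_mat[of _ n n _ n] mult_smult_distrib[of _ n n _ n])
  have "?ev t = ?ev u" if "d4_eq t u" for t u
    using that
  proof (induction rule: d4_eq.induct)
    case (add_assoc x y z)
    show ?case using ev by (simp add: assoc_add_mat[of _ n n])
  next
    case (add_comm x y)
    show ?case using ev by (simp add: comm_add_mat[of _ n n])
  next
    case (add_zero x)
    show ?case using ev[of x] by (simp add: one)
  next
    case (add_neg x)
    show ?case using ev[of x] by (auto simp: one scal intro!: eq_matI)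
  next
    case (mul_assoc x y z)
    show ?case using ev by (simp add: assoc_mult_mat[of _ n n _ n _ n])
  next
    case (mul_one x)
    show ?case using ev[of x] by (simp add: one)
  next
    case (distrib_left x y z)
    show ?case using ev by (simp add: mult_add_distrib_mat[of _ n n _ n])
  next
    case (distrib_right x y z)
    show ?case using ev by (simp add: add_mult_distrib_mat[of _ n n _ _ n])
  next
    case (scal_add r s)
    show ?case by (auto intro!: eq_matI simp: semiring_class.distrib_right)
  next
    case (scal_mul r s)
    show ?case by (auto intro!: eq_matI simp: scal)
  next
    case (scal_central r x)
    show ?case using ev[of x] by (simp add: scal)
  qed (use c rel in \<open>simp_all add: one scal mult_carrier_mat[of _ n n _ n]\<close>)
  then have abs: "?ev (rep_d4 (abs_d4 t)) = ?ev t" for t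
    using Quotient3_rep_abs[OF Quotient3_d4] d4_eq.refl by metis
  have abs_rep: "abs_d4 (rep_d4 x) = x" for x :: "'k d4"
    using Quotient3_abs_rep[OF Quotient3_d4] .
  define \<rho> where "\<rho> = (\<lambda>x. ?ev (rep_d4 x))"
  have "\<rho> (x + y) = \<rho> x + \<rho> y" "\<rho> (x * y) = \<rho> x * \<rho> y" for x y
    using abs[of "TAdd (rep_d4 x) (rep_d4 y)"] abs[of "TMul (rep_d4 x) (rep_d4 y)"]
    by (simp_all add: \<rho>_def abs_rep flip: plus_d4.abs_eq times_d4.abs_eq)
  then have "d4_rep n \<rho>"
    unfolding d4_rep_def using ev by (simp add: \<rho>_def d4_scal.abs_eq abs)
  then show ?thesis
    by (intro that[of "Abs_d4_module (n, \<rho>)"])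
      (simp_all add: mdim_Abs act_Abs \<rho>_def d4_a_def d4_b_def d4_c_def d4_d_def abs)
qed

text \<open>Take \<open>d = U\<close> nilpotent of rank one, \<open>a = - \<eta> U\<close> and
  \<open>b = c = diag(1, -1)\<close>. Then \<open>b c = 1\<close>, and \<open>d4_lin \<eta>'\<close>
  acts as \<open>(\<eta>' - \<eta>) U\<close>, which is zero at \<open>\<eta>\<close> and has no
  homology elsewhere.\<close>

lemma point_module_exists:
  fixes \<eta> :: "'k::field"
  assumes two: "(2 :: 'k) \<noteq> 0"
  obtains M where "homology_trace \<eta> M = 2" "\<And>\<eta>'. \<eta>' \<noteq> \<eta> \<Longrightarrow> homology_trace \<eta>' M = 0"
proof -
  define U :: "'k mat" where "U = mat 2 2 (\<lambda>(i, j). if i = 1 \<and> j = 0 then 1 else 0)"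
  \<comment> \<open>Since \<open>U * L + L * U = 1\<close>, a rescaling of \<open>L\<close>
    contracts any nonzero multiple of \<open>U\<close>.\<close>
  define L :: "'k mat" where "L = mat 2 2 (\<lambda>(i, j). if i = 0 \<and> j = 1 then 1 else 0)"
  define G :: "'k mat" where "G = mat 2 2 (\<lambda>(i, j). if i = j then (if i = 0 then 1 else -1) else 0)"
  have [simp]: "U \<in> carrier_mat 2 2" "L \<in> carrier_mat 2 2" "G \<in> carrier_mat 2 2"
    by (auto simp: U_def L_def G_def)
  have prods: "U * U = 0\<^sub>m 2 2" "G * G = 1\<^sub>m 2" "G * U = (-1) \<cdot>\<^sub>m U" "U * G = U"
    "U * L + L * U = 1\<^sub>m 2"
    by (rule eq_matI; auto simp: U_def L_def G_def scalar_prod_def numeral_2_eq_2 less_Suc_eq)+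
  obtain M where M: "mdim M = 2" "act M d4_a = (- \<eta>) \<cdot>\<^sub>m U" "act M d4_b = G" "act M d4_c = G" "act M d4_d = U"
  proof (rule d4_module_of_matrices[of "(- \<eta>) \<cdot>\<^sub>m U" 2 G G U])
    note mm = mult_smult_assoc_mat[of _ 2 2 _ 2] mult_smult_distrib[of _ 2 2 _ 2]
    show "G * ((- \<eta>) \<cdot>\<^sub>m U) = (-1) \<cdot>\<^sub>m ((- \<eta>) \<cdot>\<^sub>m U * G)"
      "G * ((- \<eta>) \<cdot>\<^sub>m U) = (-1) \<cdot>\<^sub>m ((- \<eta>) \<cdot>\<^sub>m U * G)"
      "U * G = (-1) \<cdot>\<^sub>m (G * U)" "U * G = (-1) \<cdot>\<^sub>m (G * U)"
      "(- \<eta>) \<cdot>\<^sub>m U * ((- \<eta>) \<cdot>\<^sub>m U) = 0\<^sub>m 2 2"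
      "U * ((- \<eta>) \<cdot>\<^sub>m U) + (- \<eta>) \<cdot>\<^sub>m U * U = 1\<^sub>m 2 + (-1) \<cdot>\<^sub>m (G * G)"
      by (simp_all add: mm prods) (auto intro!: eq_matI)
  qed (auto simp: prods)
  have "act M (1 + d4_b * d4_c) = 2 \<cdot>\<^sub>m 1\<^sub>m 2"
    by (auto intro!: eq_matI simp: act_add act_mult act_1 M prods)
  then have even: "act M d4_even = 1\<^sub>m 2"
    using two by (auto simp: d4_even_def act_scal_mult intro!: eq_matI)
  have lin: "act M (d4_lin \<eta>') = (\<eta>' - \<eta>) \<cdot>\<^sub>m U" for \<eta>'
    by (rule eq_matI) (auto simp: d4_lin_def act_add act_scal_mult M U_def algebra_simps)
  have zero: "0 \<cdot>\<^sub>m U = 0\<^sub>m 2 2" by (rule eq_matI) (auto simp: U_def)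
  show ?thesis
  proof (rule that[of M])
    have "module_homology \<eta> M (0\<^sub>m 2 2) (1\<^sub>m 2)"
      by (simp add: homology_data_def M even lin zero)
    then show "homology_trace \<eta> M = 2"
      by (simp add: homology_trace_eqI mat_trace_def)
    fix \<eta>' assume ne: "\<eta>' \<noteq> \<eta>"
    define s where "s = inverse (\<eta>' - \<eta>) \<cdot>\<^sub>m L"
    have s: "s \<in> carrier_mat 2 2" by (simp add: s_def)
    have cancel: "inverse (\<eta>' - \<eta>) \<cdot>\<^sub>m ((\<eta>' - \<eta>) \<cdot>\<^sub>m Z) = Z"
      "(\<eta>' - \<eta>) \<cdot>\<^sub>m (inverse (\<eta>' - \<eta>) \<cdot>\<^sub>m Z) = Z" for Z
      using ne by (auto intro!: eq_matI)
    have "(\<eta>' - \<eta>) \<cdot>\<^sub>m U * s + s * ((\<eta>' - \<eta>) \<cdot>\<^sub>m U) = U * L + L * U"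
      by (simp add: s_def cancel mult_smult_assoc_mat[of _ 2 2 _ 2] mult_smult_distrib[of _ 2 2 _ 2])
    then have "module_homology \<eta>' M s (0\<^sub>m 2 2)"
      using s right_mult_zero_mat[of "(\<eta>' - \<eta>) \<cdot>\<^sub>m U" 2 2 2] left_mult_zero_mat[of "(\<eta>' - \<eta>) \<cdot>\<^sub>m U" 2 2 2]
      by (simp add: homology_data_def M even lin prods)
    then show "homology_trace \<eta>' M = 0"
      by (simp add: homology_trace_eqI mat_trace_def)
  qed
qed

section \<open>The Green ring\<close>

definition frag_eval :: "('a \<Rightarrow> 'b::comm_ring_1) \<Rightarrow> ('a \<Rightarrow>\<^sub>0 int) \<Rightarrow> 'b" where
  "frag_eval g x = (\<Sum>c\<in>Poly_Mapping.keys x. of_int (Poly_Mapping.lookup x c) * g c)"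

lemma frag_eval_0 [simp]: "frag_eval g 0 = 0"
  by (simp add: frag_eval_def)

lemma frag_eval_of [simp]: "frag_eval g (frag_of c) = g c"
  by (simp add: frag_eval_def)

lemma frag_eval_superset:
  assumes "finite K" "Poly_Mapping.keys x \<subseteq> K"
  shows "frag_eval g x = (\<Sum>c\<in>K. of_int (Poly_Mapping.lookup x c) * g c)"
  unfolding frag_eval_def using assms by (intro sum.mono_neutral_left) (auto simp: in_keys_iff)

lemma frag_eval_diff [simp]: "frag_eval g (x - y) = frag_eval g x - frag_eval g y"
proof -
  let ?K = "Poly_Mapping.keys x \<union> Poly_Mapping.keys y"
  have K: "finite ?K" "Poly_Mapping.keys (x - y) \<subseteq> ?K" by (auto simp: in_keys_iff lookup_minus)
  show ?thesis
    unfolding frag_eval_superset[OF K] frag_eval_superset[OF K(1) Un_upper1] frag_eval_superset[OF K(1) Un_upper2]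
    by (simp add: lookup_minus left_diff_distrib sum_subtractf)
qed

lemma frag_eval_tensor:
  assumes "\<And>c d. g (class_tensor c d) = g c * g d"
  shows "frag_eval g (tensor_frag x y) = frag_eval g x * frag_eval g y"
proof (induction x rule: frag_induct)
  case (one c)
  show ?case
    by (induction y rule: frag_induct) (simp_all add: assms tensor_frag_diff_right right_diff_distrib)
qed (simp_all add: tensor_frag_diff_left left_diff_distrib)

lemma frag_eval_green_rel:
  assumes "\<And>c d. g (class_sum c d) = g c + g d" and "x \<in> green_rel"
  shows "frag_eval g x = 0"
  using assms(2) by induction (simp_all add: assms(1))

text \<open>The value is taken at a representative instead of being lifted, since isomorphism
  invariance is established under the assumption \<open>2 \<noteq> 0\<close>, which the type does
  not carry.\<close>

definition class_homology_trace :: "'k::field \<Rightarrow> 'k d4_class \<Rightarrow> 'k" where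
  "class_homology_trace \<eta> c = homology_trace \<eta> (rep_d4_class c)"

definition green_homology_trace :: "'k::field \<Rightarrow> 'k green_ring \<Rightarrow> 'k" where
  "green_homology_trace \<eta> z = frag_eval (class_homology_trace \<eta>) (rep_green_ring z)"

context
  assumes two: "(2 :: 'k::field) \<noteq> 0"
begin

lemma class_homology_trace_abs:
  "class_homology_trace \<eta> (abs_d4_class M) = homology_trace \<eta> (M :: 'k d4_module)"
  unfolding class_homology_trace_def
  using Quotient3_rep_abs[OF Quotient3_d4_class d4_iso_refl] by (rule homology_trace_iso[OF two])

lemma class_homology_trace_simps:
  fixes c d :: "'k d4_class"
  shows "class_homology_trace \<eta> (class_sum c d) = class_homology_trace \<eta> c + class_homology_trace \<eta> d"
    and "class_homology_trace \<eta> (class_tensor c d) = class_homology_trace \<eta> c * class_homology_trace \<eta> d"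
    and "class_homology_trace \<eta> (class_unit :: 'k d4_class) = 1"
proof -
  obtain M N where cd: "c = abs_d4_class M" "d = abs_d4_class N"
    using Quotient3_abs_rep[OF Quotient3_d4_class] by metis
  show "class_homology_trace \<eta> (class_sum c d) = class_homology_trace \<eta> c + class_homology_trace \<eta> d"
    "class_homology_trace \<eta> (class_tensor c d) = class_homology_trace \<eta> c * class_homology_trace \<eta> d"
    "class_homology_trace \<eta> (class_unit :: 'k d4_class) = 1"
    unfolding cd class_sum.abs_eq class_tensor.abs_eq class_unit_def class_homology_trace_abs
    using homology_trace_sum[OF two] homology_trace_tensor[OF two] homology_trace_unit[OF two] by auto
qed

lemma green_homology_trace_abs:
  "green_homology_trace \<eta> (abs_green_ring x) =
     frag_eval (class_homology_trace \<eta>) (x :: 'k d4_class \<Rightarrow>\<^sub>0 int)"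
proof -
  have "green_eq (rep_green_ring (abs_green_ring x)) x"
    by (rule Quotient3_rep_abs[OF Quotient3_green_ring]) (simp add: green_eq_def green_rel.zero)
  then have "frag_eval (class_homology_trace \<eta>) (rep_green_ring (abs_green_ring x) - x) = 0"
    unfolding green_eq_def
    by (intro frag_eval_green_rel) (simp_all add: class_homology_trace_simps)
  then show ?thesis by (simp add: green_homology_trace_def)
qed

lemma green_homology_trace_simps:
  fixes y z :: "'k green_ring"
  shows "green_homology_trace \<eta> (1 :: 'k green_ring) = 1"
    and "green_homology_trace \<eta> (y - z) = green_homology_trace \<eta> y - green_homology_trace \<eta> z"
    and "green_homology_trace \<eta> (y * z) = green_homology_trace \<eta> y * green_homology_trace \<eta> z"
    and "green_homology_trace \<eta> (green_class M) = homology_trace \<eta> (M :: 'k d4_module)"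
proof -
  obtain u v where yz: "y = abs_green_ring u" "z = abs_green_ring v"
    using Quotient3_abs_rep[OF Quotient3_green_ring] by metis
  show "green_homology_trace \<eta> (1 :: 'k green_ring) = 1"
    "green_homology_trace \<eta> (y - z) = green_homology_trace \<eta> y - green_homology_trace \<eta> z"
    "green_homology_trace \<eta> (y * z) = green_homology_trace \<eta> y * green_homology_trace \<eta> z"
    "green_homology_trace \<eta> (green_class M) = homology_trace \<eta> M"
    unfolding yz one_green_ring_def minus_green_ring.abs_eq times_green_ring.abs_eq green_class.abs_eq
      green_homology_trace_abs
    by (simp_all add: frag_eval_tensor class_homology_trace_simps class_homology_trace_abs)
qed

text \<open>An element involves finitely many classes, and the exceptional points of a difference
  lie in the union of two finite exceptional sets.\<close>

lemma green_homology_trace_generically_constant: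
  "\<exists>v. finite {\<eta>. green_homology_trace \<eta> (z :: 'k green_ring) \<noteq> v}"
proof -
  have "\<exists>v. finite {\<eta>. frag_eval (class_homology_trace \<eta>) (x :: 'k d4_class \<Rightarrow>\<^sub>0 int) \<noteq> v}" for x
  proof (induction x rule: frag_induct)
    case (one c)
    show ?case
      using homology_trace_generically_constant[OF two] by (simp add: class_homology_trace_def)
  next
    case (diff x y)
    then obtain v w where fin: "finite {\<eta>. frag_eval (class_homology_trace \<eta>) x \<noteq> v}"
      "finite {\<eta>. frag_eval (class_homology_trace \<eta>) y \<noteq> w}" by blast
    have "finite {\<eta>. frag_eval (class_homology_trace \<eta>) (x - y) \<noteq> v - w}"
      by (rule finite_subset[OF _ finite_UnI[OF fin]]) auto
    then show ?case by blast
  qed auto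
  then show ?thesis by (simp add: green_homology_trace_def)
qed

end

text \<open>Over a finite field, adding \<open>1\<close> to the product of all \<open>X - a\<close>
  gives a nonconstant polynomial with value \<open>1\<close> everywhere.\<close>

lemma alg_closed_field_infinite: "infinite (UNIV :: 'a::alg_closed_field set)"
proof
  assume fin: "finite (UNIV :: 'a set)"
  define p :: "'a poly" where "p = (\<Prod>a\<in>UNIV. [:- a, 1:]) + 1"
  have "Polynomial.degree (\<Prod>a\<in>(UNIV :: 'a set). [:- a, 1:]) = card (UNIV :: 'a set)"
    by (subst degree_prod_eq_sum_degree) auto
  then have "Polynomial.degree p = card (UNIV :: 'a set)"
    unfolding p_def using fin by (subst degree_add_eq_left) (auto simp: finite_UNIV_card_ge_0)
  then have "Polynomial.degree p > 0" using fin by (simp add: finite_UNIV_card_ge_0)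
  then obtain x where "poly p x = 0" using alg_closed_imp_poly_has_root by blast
  moreover have "poly p x = 1" using fin by (simp add: p_def poly_prod)
  ultimately show False by simp
qed

theorem mainTheorem3:
  assumes "CHAR('k::alg_closed_field) \<noteq> 2"
  shows "\<not> finitely_generated_ring (ring_of_type_algebra :: 'k green_ring ring)"
proof
  let ?R = "ring_of_type_algebra :: 'k green_ring ring"
  have two: "(2 :: 'k) \<noteq> 0"
  proof
    assume "(2 :: 'k) = 0"
    then have dvd: "CHAR('k) dvd 2" using of_nat_eq_0_iff_char_dvd[where 'a = 'k, of 2] by simp
    then have "CHAR('k) \<noteq> 0" by (metis dvd_0_left_iff zero_neq_numeral)
    moreover have "CHAR('k) \<le> 2" using dvd by (simp add: dvd_imp_le)
    ultimately show False using assms CHAR_not_1[where 'a = 'k] by linarith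
  qed
  assume "finitely_generated_ring ?R"
  then obtain S where S: "finite S" and gen: "generate_ring ?R S = UNIV"
    by (auto simp: finitely_generated_ring_def ring_of_type_algebra_def)
  obtain v where v: "finite {\<eta>. green_homology_trace \<eta> z \<noteq> v z}" for z :: "'k green_ring"
    using green_homology_trace_generically_constant[OF two] by metis
  \<comment> \<open>\<open>T\<close> consists of the points at which every generator takes its
    generic value. It is cofinite, hence contains two distinct points.\<close>
  define T where "T = - (\<Union>z\<in>S. {\<eta>. green_homology_trace \<eta> z \<noteq> v z})"
  have "finite (\<Union>z\<in>S. {\<eta>. green_homology_trace \<eta> z \<noteq> v z})" using S v by blast
  then have T: "infinite T"
    unfolding T_def using alg_closed_field_infinite
    by (simp add: Compl_eq_Diff_UNIV Diff_infinite_finite)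
  then obtain \<eta> where \<eta>: "\<eta> \<in> T"
    using infinite_imp_nonempty by blast
  obtain \<eta>' where \<eta>': "\<eta>' \<in> T" "\<eta>' \<noteq> \<eta>"
    using infinite_imp_nonempty[OF infinite_remove[OF T, of \<eta>]] by blast
  have "green_homology_trace \<eta> z = green_homology_trace \<eta>' z" if "z \<in> generate_ring ?R S" for z
    using that
  proof (induction rule: generate_ring.induct)
    case one
    then show ?case by (simp add: ring_of_type_algebra_def green_homology_trace_simps(1)[OF two])
  next
    case (incl z)
    then show ?case using \<eta> \<eta>'(1) by (simp add: T_def)
  next
    \<comment> \<open>Negation and addition are expressed through \<open>1\<close>, subtraction and
      multiplication, the operations covered by \<open>green_homology_trace_simps\<close>.\<close>
    case (a_inv z)
    have "\<ominus>\<^bsub>?R\<^esub> z = (1 - 1) - z"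
      unfolding a_inv_def m_inv_def
      by (rule the_equality) (auto simp: ring_of_type_algebra_def eq_neg_iff_add_eq_0 add.commute)
    then show ?case using a_inv by (simp only: green_homology_trace_simps[OF two])
  next
    case (eng_add y z)
    have "y \<oplus>\<^bsub>?R\<^esub> z = y - ((1 - 1) - z)" by (simp add: ring_of_type_algebra_def)
    then show ?case using eng_add by (simp only: green_homology_trace_simps[OF two])
  next
    case (eng_mult y z)
    then show ?case by (simp add: ring_of_type_algebra_def green_homology_trace_simps(3)[OF two])
  qed
  then have const: "green_homology_trace \<eta> z = green_homology_trace \<eta>' z" for z
    unfolding gen by simp
  \<comment> \<open>The module concentrated at \<open>\<eta>\<close> separates the two points: its
    values are \<open>2\<close> at \<open>\<eta>\<close> and \<open>0\<close> at
    \<open>\<eta>'\<close>.\<close>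
  obtain M :: "'k d4_module" where "homology_trace \<eta> M = 2" "\<And>\<eta>'. \<eta>' \<noteq> \<eta> \<Longrightarrow> homology_trace \<eta>' M = 0"
    using point_module_exists[OF two, of \<eta>] by metis
  then show False
    using const[of "green_class M"] two \<eta>'(2) by (simp add: green_homology_trace_simps(4)[OF two])
qed

end
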